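(* Let $\mathbf{G}$ be an $\ell$-group, and let $K_{I,J}^{\lambda,\rho}(\mathbf{G})$ be a kite. The following are equivalent: (1) $\mathbf{G}$ is subdirectly irreducible and for all $i,j\in I$ there exists $m\in\omega$ such that $(\rho\circ\lambda^{-1})^m(i)=j$ or $(\lambda\circ\rho^{-1})^m(i)=j$. (2) $K_{I,J}^{\lambda,\rho}(\mathbf{G})$ is subdirectly irreducible.
   Context: Kites. Let $\mathbf{G}$ be an $\ell$-group (written multiplicatively, identity $e$), $G^+=\{g: g\ge e\}$, $G^-=\{g: g\le e\}$. Let $I,J$ be sets with $|J|\le|I|$ and $\lambda,\rho\colon J\to I$ injections. The kite $K_{I,J}^{\lambda,\rho}(\mathbf{G})$ is the algebra $\langle (G^+)^J\uplus(G^-)^I;\vee,\wedge,\cdot,\backslash,/,1,0\rangle$ (disjoint union) whose order is coordinatewise inside $(G^+)^J$ and inside $(G^-)^I$, with every element of $(G^+)^J$ below every element of $(G^-)^I$. Elements of $(G^-)^I$ are written $\langle a_i^{-1}\rangle_{i\in I}$ with $a_i\in G^+$, elements of $(G^+)^J$ as $\langle f_j\rangle_{j\in J}$; $e^{-1}$ denotes $e$ as an element of $G^-$. $1$ is the constant sequence $e^{-1}$ in $(G^-)^I$ and $0$ the constant sequence $e$ in $(G^+)^J$. Multiplication: $\langle a_i^{-1}\rangle\cdot\langle b_i^{-1}\rangle=\langle (b_ia_i)^{-1}\rangle$; $\langle a_i^{-1}\rangle\cdot\langle f_j\rangle=\langle a_{\lambda(j)}^{-1}f_j\vee e\rangle_{j\in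 J}$; $\langle f_j\rangle\cdot\langle a_i^{-1}\rangle=\langle f_ja_{\rho(j)}^{-1}\vee e\rangle_{j\in J}$; $\langle f_j\rangle\cdot\langle g_j\rangle=0$. Divisions: $\langle a_i^{-1}\rangle\backslash\langle b_i^{-1}\rangle=\langle a_ib_i^{-1}\wedge e^{-1}\rangle$; $\langle b_i^{-1}\rangle/\langle a_i^{-1}\rangle=\langle b_i^{-1}a_i\wedge e^{-1}\rangle$; $\langle a_i^{-1}\rangle\backslash\langle f_j\rangle=\langle a_{\lambda(j)}f_j\rangle_{j}$; $\langle f_j\rangle/\langle a_i^{-1}\rangle=\langle f_ja_{\rho(j)}\rangle_{j}$; $\langle f_j\rangle\backslash\langle g_j\rangle$ is the element of $(G^-)^I$ whose $i$-th coordinate is $f_{\rho^{-1}(i)}^{-1}g_{\rho^{-1}(i)}\wedge e^{-1}$ if $i\in\rho(J)$ and $e^{-1}$ otherwise; $\langle g_j\rangle/\langle f_j\rangle$ is the element of $(G^-)^I$ whose $i$-th coordinate is $g_{\lambda^{-1}(i)}f_{\lambda^{-1}(i)}^{-1}\wedge e^{-1}$ if $i\in\lambda(J)$ and $e^{-1}$ otherwise; $\langle a_i^{-1}\rangle/\langle f_j\rangle=1=\langle f_j\rangle\backslash\langle a_i^{-1}\rangle$. Here $\lambda^{-1},\rho^{-1}$ are partial maps from $I$ to $J$, $\rho\circ\lambda^{-1}$ and $\lambda\circ\rho^{-1}$ are partial maps from $I$ to $I$; an equality $(\rho\circ\lambda^{-1})^m(i)=j$ means that the left side is defined and equals $j$;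 the $0$-th power is the identity; $\omega$ contains $0$. Subdirect irreducibility of $\mathbf{G}$ is as an $\ell$-group.
   Formalization: The ℓ-group G is assumed nontrivial and the index set I nonempty; otherwise the kite is the two-element algebra, which is subdirectly irreducible even when (1) fails (e.g. I empty with G = Z×Z, or G trivial with |I| = 2 and J empty). *)

theory Defs
  imports "HOL-Algebra.Group"
begin

section \<open>Universal algebra: subdirect irreducibility\<close>

text \<open>
  An algebra interprets operation symbols as functions on argument lists; only lists whose length
  is the arity of the symbol matter.
\<close>

record ('f, 'a) algebra = "'a partial_object" +
  op :: "'f \<Rightarrow> 'a list \<Rightarrow> 'a"

definition is_algebra :: "('f \<Rightarrow> nat) \<Rightarrow> ('f, 'a) algebra \<Rightarrow> bool" where
  "is_algebra ar A \<longleftrightarrow> carrier A \<noteq> {} \<and>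
     (\<forall>f xs. length xs = ar f \<and> set xs \<subseteq> carrier A \<longrightarrow> op A f xs \<in> carrier A)"

definition alg_hom ::
  "('f \<Rightarrow> nat) \<Rightarrow> ('f, 'a) algebra \<Rightarrow> ('f, 'b) algebra \<Rightarrow> ('a \<Rightarrow> 'b) \<Rightarrow> bool" where
  "alg_hom ar A B h \<longleftrightarrow> h \<in> carrier A \<rightarrow> carrier B \<and>
     (\<forall>f xs. length xs = ar f \<and> set xs \<subseteq> carrier A \<longrightarrow> h (op A f xs) = op B f (map h xs))"

definition alg_iso ::
  "('f \<Rightarrow> nat) \<Rightarrow> ('f, 'a) algebra \<Rightarrow> ('f, 'b) algebra \<Rightarrow> ('a \<Rightarrow> 'b) \<Rightarrow> bool" where
  "alg_iso ar A B h \<longleftrightarrow> alg_hom ar A B h \<and> bij_betw h (carrier A) (carrier B)"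

definition alg_prod :: "'k set \<Rightarrow> ('k \<Rightarrow> ('f, 'b) algebra) \<Rightarrow> ('f, 'k \<Rightarrow> 'b) algebra" where
  "alg_prod K B =
     \<lparr>carrier = (\<Pi>\<^sub>E k\<in>K. carrier (B k)),
      op = (\<lambda>f xs. \<lambda>k\<in>K. op (B k) f (map (\<lambda>x. x k) xs))\<rparr>"

definition subdirect_embedding ::
  "('f \<Rightarrow> nat) \<Rightarrow> ('f, 'a) algebra \<Rightarrow> 'k set \<Rightarrow> ('k \<Rightarrow> ('f, 'b) algebra) \<Rightarrow> ('a \<Rightarrow> 'k \<Rightarrow> 'b) \<Rightarrow> bool"
  where
  "subdirect_embedding ar A K B \<alpha> \<longleftrightarrow>
     (\<forall>k\<in>K. is_algebra ar (B k)) \<and>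
     alg_hom ar A (alg_prod K B) \<alpha> \<and> inj_on \<alpha> (carrier A) \<and>
     (\<forall>k\<in>K. (\<lambda>x. \<alpha> x k) ` carrier A = carrier (B k))"

text \<open>
  A defining formula cannot quantify over types, so the index set and the factors range over two
  fixed types, which have room for all congruences of the algebra and all its quotients.
  By \<open>subdirectly_irreducible_any_family\<close> below, nothing is lost: the property then holds for
  families over arbitrary types. The empty family is allowed, so a one-element
  algebra is not subdirectly irreducible.
\<close>

definition subdirectly_irreducible :: "('f \<Rightarrow> nat) \<Rightarrow> ('f, 'a) algebra \<Rightarrow> bool" where
  "subdirectly_irreducible ar A \<longleftrightarrow> is_algebra ar A \<and>
     (\<forall>(K :: ('a \<times> 'a) set set) (B :: ('a \<times> 'a) set \<Rightarrow> ('f, 'a set) algebra) \<alpha>.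
        subdirect_embedding ar A K B \<alpha> \<longrightarrow> (\<exists>k\<in>K. alg_iso ar A (B k) (\<lambda>x. \<alpha> x k)))"

definition quotient_alg :: "('f, 'a) algebra \<Rightarrow> ('a \<times> 'a) set \<Rightarrow> ('f, 'a set) algebra" where
  "quotient_alg A \<theta> =
     \<lparr>carrier = carrier A // \<theta>,
      op = (\<lambda>f Xs. \<theta> `` {op A f (map (\<lambda>X. SOME x. x \<in> X) Xs)})\<rparr>"

lemma alg_hom_quotient:
  fixes A :: "('f, 'a) algebra" and B :: "('f, 'b) algebra"
  assumes A: "is_algebra ar A" and h: "alg_hom ar A B h"
  defines "\<theta> \<equiv> {(x, y). x \<in> carrier A \<and> y \<in> carrier A \<and> h x = h y}"
  shows "is_algebra ar (quotient_alg A \<theta>)"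
    and "\<And>f xs. length xs = ar f \<Longrightarrow> set xs \<subseteq> carrier A \<Longrightarrow>
           \<theta> `` {op A f xs} = op (quotient_alg A \<theta>) f (map (\<lambda>x. \<theta> `` {x}) xs)"
proof -
  have rep: "(SOME y. y \<in> \<theta> `` {x}) \<in> carrier A \<and> h (SOME y. y \<in> \<theta> `` {x}) = h x"
    if "x \<in> carrier A" for x
  proof -
    have "x \<in> \<theta> `` {x}" using that by (auto simp: \<theta>_def)
    then have "(SOME y. y \<in> \<theta> `` {x}) \<in> \<theta> `` {x}" by (rule someI)
    then show ?thesis by (auto simp: \<theta>_def)
  qed
  show "\<theta> `` {op A f xs} = op (quotient_alg A \<theta>) f (map (\<lambda>x. \<theta> `` {x}) xs)"
    if len: "length xs = ar f" and sub: "set xs \<subseteq> carrier A" for f xs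
  proof -
    let ?ys = "map (\<lambda>x. SOME y. y \<in> \<theta> `` {x}) xs"
    have ys: "set ?ys \<subseteq> carrier A" using sub rep by auto
    have "map h ?ys = map h xs" using sub rep by auto
    then have "h (op A f ?ys) = h (op A f xs)"
      using h len ys sub by (simp add: alg_hom_def del: map_map)
    moreover have "op A f ?ys \<in> carrier A" "op A f xs \<in> carrier A"
      using A len ys sub by (auto simp: is_algebra_def simp del: set_map)
    ultimately have "\<theta> `` {op A f xs} = \<theta> `` {op A f ?ys}" by (auto simp: \<theta>_def)
    then show ?thesis by (simp add: quotient_alg_def o_def)
  qed
  show "is_algebra ar (quotient_alg A \<theta>)"
    unfolding is_algebra_def
  proof (intro conjI allI impI)
    show "carrier (quotient_alg A \<theta>) \<noteq> {}"
      using A by (auto simp: is_algebra_def quotient_alg_def quotient_def)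
    fix f and Xs :: "'a set list"
    assume "length Xs = ar f \<and> set Xs \<subseteq> carrier (quotient_alg A \<theta>)"
    then have len: "length Xs = ar f" and sub: "set Xs \<subseteq> carrier A // \<theta>"
      by (auto simp: quotient_alg_def)
    have "(SOME x. x \<in> X) \<in> carrier A" if "X \<in> set Xs" for X
      using that sub rep by (auto simp: quotient_def)
    then have "op A f (map (\<lambda>X. SOME x. x \<in> X) Xs) \<in> carrier A"
      using A len by (auto simp: is_algebra_def image_subset_iff)
    then show "op (quotient_alg A \<theta>) f Xs \<in> carrier (quotient_alg A \<theta>)"
      by (auto simp: quotient_alg_def quotient_def)
  qed
qed

lemma subdirectly_irreducible_any_family:
  fixes A :: "('f, 'a) algebra" and B :: "'k \<Rightarrow> ('f, 'b) algebra"
  assumes si: "subdirectly_irreducible ar A" and emb: "subdirect_embedding ar A K B \<alpha>"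
  shows "\<exists>k\<in>K. alg_iso ar A (B k) (\<lambda>x. \<alpha> x k)"
proof -
  define \<theta> where "\<theta> k = {(x, y). x \<in> carrier A \<and> y \<in> carrier A \<and> \<alpha> x k = \<alpha> y k}" for k
  define \<beta> where "\<beta> x = (\<lambda>t\<in>\<theta> ` K. t `` {x})" for x
  have A: "is_algebra ar A" using si by (simp add: subdirectly_irreducible_def)
  have \<alpha>: "\<alpha> \<in> carrier A \<rightarrow> (\<Pi>\<^sub>E k\<in>K. carrier (B k))" and inj: "inj_on \<alpha> (carrier A)"
    using emb by (auto simp: subdirect_embedding_def alg_hom_def alg_prod_def)
  have hom: "alg_hom ar A (B k) (\<lambda>x. \<alpha> x k)" if "k \<in> K" for k
    using emb that
    by (auto simp: subdirect_embedding_def alg_hom_def alg_prod_def o_def PiE_def Pi_def)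
  note quot = alg_hom_quotient[OF A hom, folded \<theta>_def]
  have "alg_hom ar A (alg_prod (\<theta> ` K) (quotient_alg A)) \<beta>"
    unfolding alg_hom_def
  proof (intro conjI allI impI)
    show "\<beta> \<in> carrier A \<rightarrow> carrier (alg_prod (\<theta> ` K) (quotient_alg A))"
      by (auto simp: alg_prod_def \<beta>_def quotient_alg_def quotientI)
    fix f and xs :: "'a list"
    assume "length xs = ar f \<and> set xs \<subseteq> carrier A"
    then show "\<beta> (op A f xs) = op (alg_prod (\<theta> ` K) (quotient_alg A)) f (map \<beta> xs)"
      by (simp add: alg_prod_def \<beta>_def o_def)
        (rule restrict_ext, erule imageE, simp add: quot(2))
  qed
  moreover have "inj_on \<beta> (carrier A)"
  proof (rule inj_onI)
    fix x y assume x: "x \<in> carrier A" and y: "y \<in> carrier A" and eq: "\<beta> x = \<beta> y"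
    have "\<alpha> x k = \<alpha> y k" if "k \<in> K" for k
    proof -
      have "\<theta> k `` {x} = \<theta> k `` {y}"
        using fun_cong[OF eq, of "\<theta> k"] that by (simp add: \<beta>_def)
      moreover have "y \<in> \<theta> k `` {y}" using y by (simp add: \<theta>_def)
      ultimately show ?thesis by (auto simp: \<theta>_def)
    qed
    then have "\<alpha> x = \<alpha> y" using \<alpha> x y by (intro PiE_ext[of _ K "\<lambda>k. carrier (B k)"]) auto
    then show "x = y" using inj x y by (simp add: inj_on_def)
  qed
  moreover have "(\<lambda>x. \<beta> x t) ` carrier A = carrier (quotient_alg A t)" if "t \<in> \<theta> ` K" for t
    using that by (auto simp: \<beta>_def quotient_alg_def quotient_def)
  ultimately have "subdirect_embedding ar A (\<theta> ` K) (quotient_alg A) \<beta>"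
    using quot(1) by (auto simp: subdirect_embedding_def)
  then obtain k where k: "k \<in> K" and iso: "alg_iso ar A (quotient_alg A (\<theta> k)) (\<lambda>x. \<beta> x (\<theta> k))"
    using si unfolding subdirectly_irreducible_def by blast
  have "inj_on (\<lambda>x. \<alpha> x k) (carrier A)"
  proof (rule inj_onI)
    fix x y assume xy: "x \<in> carrier A" "y \<in> carrier A" "\<alpha> x k = \<alpha> y k"
    then have "\<beta> x (\<theta> k) = \<beta> y (\<theta> k)" using k by (auto simp: \<beta>_def \<theta>_def)
    then show "x = y" using iso xy by (auto simp: alg_iso_def bij_betw_def inj_on_def)
  qed
  then have "alg_iso ar A (B k) (\<lambda>x. \<alpha> x k)"
    using hom[OF k] emb k by (auto simp: alg_iso_def bij_betw_def subdirect_embedding_def)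
  then show ?thesis using k by blast
qed


section \<open>Lattice-ordered groups\<close>

text \<open>
  The order is part of the structure; joins and meets are those the library derives from it, and
  they are operations of the algebra \<open>lgroup_alg\<close> whose subdirect irreducibility is at issue.
\<close>

record 'a lgroup = "'a monoid" +
  lle :: "'a \<Rightarrow> 'a \<Rightarrow> bool"

definition lgroup_order :: "('a, 'm) lgroup_scheme \<Rightarrow> 'a gorder" where
  "lgroup_order G = \<lparr>carrier = carrier G, eq = (=), le = lle G\<rparr>"

locale lgroup = group G for G :: "('a, 'm) lgroup_scheme" (structure) +
  assumes lattice_order: "lattice (lgroup_order G)"
    and translation_mono:
      "\<lbrakk>x \<in> carrier G; y \<in> carrier G; u \<in> carrier G; v \<in> carrier G; lle G x y\<rbrakk>
        \<Longrightarrow> lle G (u \<otimes> x \<otimes> v) (u \<otimes> y \<otimes> v)"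

definition ljoin :: "('a, 'm) lgroup_scheme \<Rightarrow> 'a \<Rightarrow> 'a \<Rightarrow> 'a" where
  "ljoin G x y = x \<squnion>\<^bsub>lgroup_order G\<^esub> y"

definition lmeet :: "('a, 'm) lgroup_scheme \<Rightarrow> 'a \<Rightarrow> 'a \<Rightarrow> 'a" where
  "lmeet G x y = x \<sqinter>\<^bsub>lgroup_order G\<^esub> y"

definition pos_cone :: "('a, 'm) lgroup_scheme \<Rightarrow> 'a set" where
  "pos_cone G = {g \<in> carrier G. lle G \<one>\<^bsub>G\<^esub> g}"

definition neg_cone :: "('a, 'm) lgroup_scheme \<Rightarrow> 'a set" where
  "neg_cone G = {g \<in> carrier G. lle G g \<one>\<^bsub>G\<^esub>}"

datatype lgroup_sym = GJoin | GMeet | GMult | GInv | GOne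

fun lgroup_ar :: "lgroup_sym \<Rightarrow> nat" where
  "lgroup_ar GJoin = 2"
| "lgroup_ar GMeet = 2"
| "lgroup_ar GMult = 2"
| "lgroup_ar GInv = 1"
| "lgroup_ar GOne = 0"

definition lgroup_alg :: "('a, 'm) lgroup_scheme \<Rightarrow> (lgroup_sym, 'a) algebra" where
  "lgroup_alg G =
     \<lparr>carrier = carrier G,
      op = (\<lambda>f xs. case f of
          GJoin \<Rightarrow> ljoin G (xs ! 0) (xs ! 1)
        | GMeet \<Rightarrow> lmeet G (xs ! 0) (xs ! 1)
        | GMult \<Rightarrow> xs ! 0 \<otimes>\<^bsub>G\<^esub> xs ! 1
        | GInv \<Rightarrow> inv\<^bsub>G\<^esub> (xs ! 0)
        | GOne \<Rightarrow> \<one>\<^bsub>G\<^esub>)\<rparr>"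


section \<open>Kites\<close>

text \<open>
  \<open>Inl f\<close> stands for the sequence \<open>f\<close> in \<open>(G\<^sup>+)\<^sup>J\<close> and \<open>Inr x\<close> for the sequence \<open>x\<close> in \<open>(G\<^sup>-)\<^sup>I\<close>.
  A sequence written \<open>\<langle>a\<^sub>i\<^sup>-\<^sup>1\<rangle>\<close> on paper is stored as \<open>x\<^sub>i = a\<^sub>i\<^sup>-\<^sup>1\<close>, so \<open>a\<^sub>i\<close> appears as
  \<open>inv x\<^sub>i\<close>, and the product \<open>\<langle>(b\<^sub>i a\<^sub>i)\<^sup>-\<^sup>1\<rangle>\<close> as \<open>x\<^sub>i \<otimes> y\<^sub>i\<close>.
\<close>

type_synonym ('a, 'i, 'j) kite_elt = "('j \<Rightarrow> 'a) + ('i \<Rightarrow> 'a)"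

definition kite_carrier ::
  "('a, 'm) lgroup_scheme \<Rightarrow> 'i set \<Rightarrow> 'j set \<Rightarrow> ('a, 'i, 'j) kite_elt set" where
  "kite_carrier G I J = (J \<rightarrow>\<^sub>E pos_cone G) <+> (I \<rightarrow>\<^sub>E neg_cone G)"

context
  fixes G :: "('a, 'm) lgroup_scheme" (structure)
    and I :: "'i set" and J :: "'j set" and lam rho :: "'j \<Rightarrow> 'i"
begin

fun kite_join :: "('a, 'i, 'j) kite_elt \<Rightarrow> ('a, 'i, 'j) kite_elt \<Rightarrow> ('a, 'i, 'j) kite_elt" where
  "kite_join (Inr x) (Inr y) = Inr (\<lambda>i\<in>I. ljoin G (x i) (y i))"
| "kite_join (Inr x) (Inl g) = Inr x"
| "kite_join (Inl f) (Inr y) = Inr y"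
| "kite_join (Inl f) (Inl g) = Inl (\<lambda>j\<in>J. ljoin G (f j) (g j))"

fun kite_meet :: "('a, 'i, 'j) kite_elt \<Rightarrow> ('a, 'i, 'j) kite_elt \<Rightarrow> ('a, 'i, 'j) kite_elt" where
  "kite_meet (Inr x) (Inr y) = Inr (\<lambda>i\<in>I. lmeet G (x i) (y i))"
| "kite_meet (Inr x) (Inl g) = Inl g"
| "kite_meet (Inl f) (Inr y) = Inl f"
| "kite_meet (Inl f) (Inl g) = Inl (\<lambda>j\<in>J. lmeet G (f j) (g j))"

definition kite_one :: "('a, 'i, 'j) kite_elt" where
  "kite_one = Inr (\<lambda>i\<in>I. \<one>)"

definition kite_zero :: "('a, 'i, 'j) kite_elt" where
  "kite_zero = Inl (\<lambda>j\<in>J. \<one>)"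

fun kite_mult :: "('a, 'i, 'j) kite_elt \<Rightarrow> ('a, 'i, 'j) kite_elt \<Rightarrow> ('a, 'i, 'j) kite_elt" where
  "kite_mult (Inr x) (Inr y) = Inr (\<lambda>i\<in>I. x i \<otimes> y i)"
| "kite_mult (Inr x) (Inl f) = Inl (\<lambda>j\<in>J. ljoin G (x (lam j) \<otimes> f j) \<one>)"
| "kite_mult (Inl f) (Inr x) = Inl (\<lambda>j\<in>J. ljoin G (f j \<otimes> x (rho j)) \<one>)"
| "kite_mult (Inl f) (Inl g) = kite_zero"

text \<open>\<open>kite_ldiv u v\<close> is \<open>u \ v\<close> and \<open>kite_rdiv v u\<close> is \<open>v / u\<close>.\<close>

fun kite_ldiv :: "('a, 'i, 'j) kite_elt \<Rightarrow> ('a, 'i, 'j) kite_elt \<Rightarrow> ('a, 'i, 'j) kite_elt" where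
  "kite_ldiv (Inr x) (Inr y) = Inr (\<lambda>i\<in>I. lmeet G (inv (x i) \<otimes> y i) \<one>)"
| "kite_ldiv (Inr x) (Inl f) = Inl (\<lambda>j\<in>J. inv (x (lam j)) \<otimes> f j)"
| "kite_ldiv (Inl f) (Inr x) = kite_one"
| "kite_ldiv (Inl f) (Inl g) =
     Inr (\<lambda>i\<in>I. if i \<in> rho ` J
                then lmeet G (inv (f (the_inv_into J rho i)) \<otimes> g (the_inv_into J rho i)) \<one>
                else \<one>)"

fun kite_rdiv :: "('a, 'i, 'j) kite_elt \<Rightarrow> ('a, 'i, 'j) kite_elt \<Rightarrow> ('a, 'i, 'j) kite_elt" where
  "kite_rdiv (Inr y) (Inr x) = Inr (\<lambda>i\<in>I. lmeet G (y i \<otimes> inv (x i)) \<one>)"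
| "kite_rdiv (Inl f) (Inr x) = Inl (\<lambda>j\<in>J. f j \<otimes> inv (x (rho j)))"
| "kite_rdiv (Inr x) (Inl f) = kite_one"
| "kite_rdiv (Inl g) (Inl f) =
     Inr (\<lambda>i\<in>I. if i \<in> lam ` J
                then lmeet G (g (the_inv_into J lam i) \<otimes> inv (f (the_inv_into J lam i))) \<one>
                else \<one>)"

end

datatype kite_sym = KJoin | KMeet | KMult | KLdiv | KRdiv | KOne | KZero

fun kite_ar :: "kite_sym \<Rightarrow> nat" where
  "kite_ar KJoin = 2"
| "kite_ar KMeet = 2"
| "kite_ar KMult = 2"
| "kite_ar KLdiv = 2"
| "kite_ar KRdiv = 2"
| "kite_ar KOne = 0"
| "kite_ar KZero = 0"

definition kite ::
  "('a, 'm) lgroup_scheme \<Rightarrow> 'i set \<Rightarrow> 'j set \<Rightarrow> ('j \<Rightarrow> 'i) \<Rightarrow> ('j \<Rightarrow> 'i)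
     \<Rightarrow> (kite_sym, ('a, 'i, 'j) kite_elt) algebra" where
  "kite G I J lam rho =
     \<lparr>carrier = kite_carrier G I J,
      op = (\<lambda>f us. case f of
          KJoin \<Rightarrow> kite_join G I J (us ! 0) (us ! 1)
        | KMeet \<Rightarrow> kite_meet G I J (us ! 0) (us ! 1)
        | KMult \<Rightarrow> kite_mult G I J lam rho (us ! 0) (us ! 1)
        | KLdiv \<Rightarrow> kite_ldiv G I J lam rho (us ! 0) (us ! 1)
        | KRdiv \<Rightarrow> kite_rdiv G I J lam rho (us ! 0) (us ! 1)
        | KOne \<Rightarrow> kite_one G I
        | KZero \<Rightarrow> kite_zero G J)\<rparr>"


section \<open>Partial maps on the index set\<close>

definition partial_inv :: "'j set \<Rightarrow> ('j \<Rightarrow> 'i) \<Rightarrow> 'i \<rightharpoonup> 'j" where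
  "partial_inv J h = (\<lambda>i. if i \<in> h ` J then Some (the_inv_into J h i) else None)"

primrec partial_pow :: "('i \<rightharpoonup> 'i) \<Rightarrow> nat \<Rightarrow> 'i \<rightharpoonup> 'i" where
  "partial_pow p 0 = Some"
| "partial_pow p (Suc m) = p \<circ>\<^sub>m partial_pow p m"

end

theory Submission
  imports Defs
begin

text \<open>
  An algebra is subdirectly irreducible iff some pair \<open>a \<noteq> b\<close> lies in all its nontrivial congruences.
  A nontrivial congruence of the kite identifies \<open>1\<close> with a sequence that is \<open>c < e\<close> at one index \<open>i\<close>
  and \<open>e\<close> elsewhere; the \<open>c\<close> that occur at \<open>i\<close> form a normal filter of \<open>G\<^sup>-\<close>, and the filters at
  \<open>\<lambda>(j)\<close> and \<open>\<rho>(j)\<close> agree, because multiplying and dividing by a sequence supported at \<open>j\<close> moves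
  \<open>c\<close> from one to the other. Conversely, congruences \<open>\<phi>\<^sub>i\<close> of \<open>G\<close> with \<open>\<phi>\<close> equal at \<open>\<lambda>(j)\<close> and
  \<open>\<rho>(j)\<close> act coordinatewise as a congruence of the kite. A constant family transfers the monolith of
  the kite to \<open>G\<close>; if the index set is disconnected, the families that are trivial on a component
  and on its complement give two nontrivial congruences with trivial intersection.
\<close>

section \<open>Congruences and subdirect irreducibility\<close>

definition alg_cong :: "('f \<Rightarrow> nat) \<Rightarrow> ('f, 'a) algebra \<Rightarrow> ('a \<times> 'a) set \<Rightarrow> bool" where
  "alg_cong ar A \<theta> \<longleftrightarrow> equiv (carrier A) \<theta> \<and>
     (\<forall>f xs ys. length xs = ar f \<and> list_all2 (\<lambda>x y. (x, y) \<in> \<theta>) xs ys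
        \<longrightarrow> (op A f xs, op A f ys) \<in> \<theta>)"

text \<open>Stands in for the monolith, the least nontrivial congruence: two distinct elements
  identified by every nontrivial congruence. A single pair is easy to carry between \<open>G\<close>
  and the kite, and \<open>a \<noteq> b\<close> rules out the one-element algebra.\<close>

definition monolith_pair :: "('f \<Rightarrow> nat) \<Rightarrow> ('f, 'a) algebra \<Rightarrow> 'a \<Rightarrow> 'a \<Rightarrow> bool" where
  "monolith_pair ar A a b \<longleftrightarrow> a \<in> carrier A \<and> b \<in> carrier A \<and> a \<noteq> b \<and>
     (\<forall>\<theta> x y. alg_cong ar A \<theta> \<and> (x, y) \<in> \<theta> \<and> x \<noteq> y \<longrightarrow> (a, b) \<in> \<theta>)"

lemma monolith_pairD:
  "monolith_pair ar A a b \<Longrightarrow> alg_cong ar A \<theta> \<Longrightarrow> (x, y) \<in> \<theta> \<Longrightarrow> x \<noteq> y \<Longrightarrow> (a, b) \<in> \<theta>"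
  by (auto simp: monolith_pair_def)

lemma alg_cong_equiv: "alg_cong ar A \<theta> \<Longrightarrow> equiv (carrier A) \<theta>"
  by (simp add: alg_cong_def)

lemma alg_cong_refl: "alg_cong ar A \<theta> \<Longrightarrow> x \<in> carrier A \<Longrightarrow> (x, x) \<in> \<theta>"
  by (auto simp: alg_cong_def equiv_def refl_on_def)

lemma alg_cong_sym: "alg_cong ar A \<theta> \<Longrightarrow> (x, y) \<in> \<theta> \<Longrightarrow> (y, x) \<in> \<theta>"
  by (auto simp: alg_cong_def equiv_def sym_def)

lemma alg_cong_trans: "alg_cong ar A \<theta> \<Longrightarrow> (x, y) \<in> \<theta> \<Longrightarrow> (y, z) \<in> \<theta> \<Longrightarrow> (x, z) \<in> \<theta>"
  by (auto simp: alg_cong_def equiv_def trans_def)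

lemma alg_cong_carrier:
  assumes "alg_cong ar A \<theta>" "(x, y) \<in> \<theta>"
  shows "x \<in> carrier A" "y \<in> carrier A"
  using assms equiv_type[OF alg_cong_equiv] by blast+

lemma alg_cong_op1:
  "alg_cong ar A \<theta> \<Longrightarrow> ar f = 1 \<Longrightarrow> (x, y) \<in> \<theta> \<Longrightarrow> (op A f [x], op A f [y]) \<in> \<theta>"
  by (simp add: alg_cong_def)

lemma alg_cong_op2:
  "alg_cong ar A \<theta> \<Longrightarrow> ar f = 2 \<Longrightarrow> (x, y) \<in> \<theta> \<Longrightarrow> (x', y') \<in> \<theta> \<Longrightarrow>
    (op A f [x, x'], op A f [y, y']) \<in> \<theta>"
  by (simp add: alg_cong_def)

lemma alg_cong_kernel:
  assumes A: "is_algebra ar A" and h: "alg_hom ar A B h"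
  shows "alg_cong ar A {(x, y). x \<in> carrier A \<and> y \<in> carrier A \<and> h x = h y}" (is "alg_cong ar A ?\<theta>")
  unfolding alg_cong_def
proof (intro conjI allI impI)
  show "equiv (carrier A) ?\<theta>"
    by (auto simp: equiv_def refl_on_def sym_def trans_def)
  fix f xs ys
  assume "length xs = ar f \<and> list_all2 (\<lambda>x y. (x, y) \<in> ?\<theta>) xs ys"
  then have len: "length xs = ar f" "length ys = ar f"
    and all: "list_all2 (\<lambda>x y. (x, y) \<in> ?\<theta>) xs ys"
    by (auto dest: list_all2_lengthD)
  from all have sub: "set xs \<subseteq> carrier A" "set ys \<subseteq> carrier A" and "map h xs = map h ys"
    by (induction rule: list_all2_induct) auto
  then have "h (op A f xs) = h (op A f ys)"
    using h len by (simp add: alg_hom_def)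
  then show "(op A f xs, op A f ys) \<in> ?\<theta>"
    using A len sub by (auto simp: is_algebra_def)
qed

lemma alg_hom_canonical:
  assumes A: "is_algebra ar A" and \<theta>: "alg_cong ar A \<theta>"
  shows "alg_hom ar A (quotient_alg A \<theta>) (\<lambda>x. \<theta> `` {x})"
  unfolding alg_hom_def
proof (intro conjI allI impI)
  show "(\<lambda>x. \<theta> `` {x}) \<in> carrier A \<rightarrow> carrier (quotient_alg A \<theta>)"
    by (auto simp: quotient_alg_def quotientI)
  fix f xs assume "length xs = ar f \<and> set xs \<subseteq> carrier A"
  then have len: "length xs = ar f" and sub: "set xs \<subseteq> carrier A" by auto
  \<comment> \<open>\<open>quotient_alg\<close> computes with chosen representatives. Each is
    congruent to the element it replaces, so compatibility makes the choice harmless.\<close>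
  have "(x, SOME y. y \<in> \<theta> `` {x}) \<in> \<theta>" if "x \<in> carrier A" for x
    using someI[of "\<lambda>y. y \<in> \<theta> `` {x}" x] alg_cong_refl[OF \<theta> that] by auto
  then have "list_all2 (\<lambda>x y. (x, y) \<in> \<theta>) xs (map (\<lambda>x. SOME y. y \<in> \<theta> `` {x}) xs)"
    using sub by (induction xs) auto
  then have "(op A f xs, op A f (map (\<lambda>x. SOME y. y \<in> \<theta> `` {x}) xs)) \<in> \<theta>"
    using \<theta> len by (simp add: alg_cong_def)
  then show "\<theta> `` {op A f xs} = op (quotient_alg A \<theta>) f (map (\<lambda>x. \<theta> `` {x}) xs)"
    using equiv_class_eq[OF alg_cong_equiv[OF \<theta>]] by (simp add: quotient_alg_def o_def)
qed

lemma quotient_is_algebra: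
  assumes A: "is_algebra ar A" and \<theta>: "alg_cong ar A \<theta>"
  shows "is_algebra ar (quotient_alg A \<theta>)"
proof -
  \<comment> \<open>A congruence is the kernel of its canonical map, so
    \<open>alg_hom_quotient\<close>, which treats kernels, covers all congruences.\<close>
  have "{(x, y). x \<in> carrier A \<and> y \<in> carrier A \<and> \<theta> `` {x} = \<theta> `` {y}} = \<theta>"
    using alg_cong_carrier[OF \<theta>] eq_equiv_class_iff[OF alg_cong_equiv[OF \<theta>]] by blast
  then show ?thesis
    using alg_hom_quotient(1)[OF A alg_hom_canonical[OF A \<theta>]] by simp
qed

text \<open>By injectivity some coordinate \<open>k\<close> of the embedding separates
  \<open>a\<close> and \<open>b\<close>. The kernel of that coordinate map misses
  \<open>(a, b)\<close>, hence is trivial, and the map is an isomorphism.\<close>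

lemma subdirectly_irreducibleI:
  fixes A :: "('f, 'a) algebra"
  assumes A: "is_algebra ar A" and m: "monolith_pair ar A a b"
  shows "subdirectly_irreducible ar A"
  unfolding subdirectly_irreducible_def
proof (intro conjI allI impI)
  fix K :: "('a \<times> 'a) set set" and B :: "('a \<times> 'a) set \<Rightarrow> ('f, 'a set) algebra" and \<alpha>
  assume emb: "subdirect_embedding ar A K B \<alpha>"
  have ab: "a \<in> carrier A" "b \<in> carrier A" "a \<noteq> b" using m by (auto simp: monolith_pair_def)
  have \<alpha>: "\<alpha> \<in> carrier A \<rightarrow> (\<Pi>\<^sub>E k\<in>K. carrier (B k))" and inj: "inj_on \<alpha> (carrier A)"
    using emb by (auto simp: subdirect_embedding_def alg_hom_def alg_prod_def)
  have hom: "alg_hom ar A (B k) (\<lambda>x. \<alpha> x k)" if "k \<in> K" for k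
    using emb that
    by (auto simp: subdirect_embedding_def alg_hom_def alg_prod_def o_def PiE_def Pi_def)
  have "\<alpha> a \<noteq> \<alpha> b" using inj ab by (auto simp: inj_on_def)
  then obtain k where k: "k \<in> K" "\<alpha> a k \<noteq> \<alpha> b k"
    using PiE_ext[OF funcset_mem[OF \<alpha> ab(1)] funcset_mem[OF \<alpha> ab(2)]] by blast
  have "inj_on (\<lambda>x. \<alpha> x k) (carrier A)"
  proof (rule inj_onI, rule ccontr)
    fix x y assume "x \<in> carrier A" "y \<in> carrier A" "\<alpha> x k = \<alpha> y k" "x \<noteq> y"
    then have "(a, b) \<in> {(x, y). x \<in> carrier A \<and> y \<in> carrier A \<and> \<alpha> x k = \<alpha> y k}"
      by (intro monolith_pairD[OF m alg_cong_kernel[OF A hom[OF k(1)]], of x y]) auto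
    then show False using k by simp
  qed
  then show "\<exists>k\<in>K. alg_iso ar A (B k) (\<lambda>x. \<alpha> x k)"
    using hom[OF k(1)] emb k by (auto simp: alg_iso_def bij_betw_def subdirect_embedding_def)
qed (rule A)

text \<open>The algebra is mapped into the product of its quotients by all nontrivial congruences.
  Without a monolith pair this map is injective, so irreducibility makes one of the quotient maps
  injective, although its kernel is nontrivial.\<close>

lemma subdirectly_irreducibleD:
  fixes A :: "('f, 'a) algebra"
  assumes si: "subdirectly_irreducible ar A"
  shows "\<exists>a b. monolith_pair ar A a b"
proof (rule ccontr)
  assume none: "\<not> ?thesis"
  have A: "is_algebra ar A" using si by (simp add: subdirectly_irreducible_def)
  define K where "K = {\<theta>. alg_cong ar A \<theta> \<and> (\<exists>x y. (x, y) \<in> \<theta> \<and> x \<noteq> y)}"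
  define \<alpha> where "\<alpha> x = (\<lambda>\<theta>\<in>K. \<theta> `` {x})" for x
  have K: "alg_cong ar A \<theta>" if "\<theta> \<in> K" for \<theta> using that by (simp add: K_def)
  note hom = alg_hom_canonical[OF A K]
  have "alg_hom ar A (alg_prod K (quotient_alg A)) \<alpha>"
    unfolding alg_hom_def
  proof (intro conjI allI impI)
    show "\<alpha> \<in> carrier A \<rightarrow> carrier (alg_prod K (quotient_alg A))"
      using hom by (fastforce simp: alg_prod_def \<alpha>_def alg_hom_def)
    fix f and xs :: "'a list"
    assume "length xs = ar f \<and> set xs \<subseteq> carrier A"
    then show "\<alpha> (op A f xs) = op (alg_prod K (quotient_alg A)) f (map \<alpha> xs)"
      using hom by (simp add: alg_prod_def \<alpha>_def o_def alg_hom_def cong: restrict_cong)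
  qed
  moreover have "inj_on \<alpha> (carrier A)"
  proof (rule inj_onI, rule ccontr)
    fix x y assume xy: "x \<in> carrier A" "y \<in> carrier A" "\<alpha> x = \<alpha> y" "x \<noteq> y"
    \<comment> \<open>Elements with the same image are identified by every nontrivial congruence, so
      they would form a monolith pair.\<close>
    have "(x, y) \<in> \<theta>" if "\<theta> \<in> K" for \<theta>
      using fun_cong[OF xy(3), of \<theta>] that xy eq_equiv_class_iff[OF alg_cong_equiv[OF K[OF that]]]
      by (simp add: \<alpha>_def)
    then have "monolith_pair ar A x y" using xy by (auto simp: monolith_pair_def K_def)
    then show False using none by blast
  qed
  moreover have "(\<lambda>x. \<alpha> x \<theta>) ` carrier A = carrier (quotient_alg A \<theta>)" if "\<theta> \<in> K" for \<theta>
    using that by (auto simp: \<alpha>_def quotient_alg_def quotient_def)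
  ultimately have "subdirect_embedding ar A K (quotient_alg A) \<alpha>"
    using quotient_is_algebra[OF A K] by (auto simp: subdirect_embedding_def)
  then obtain \<theta> where \<theta>: "\<theta> \<in> K" and iso: "alg_iso ar A (quotient_alg A \<theta>) (\<lambda>x. \<alpha> x \<theta>)"
    using si unfolding subdirectly_irreducible_def by blast
  from \<theta> obtain x y where xy: "(x, y) \<in> \<theta>" "x \<noteq> y" by (auto simp: K_def)
  then have "\<alpha> x \<theta> = \<alpha> y \<theta>"
    using \<theta> equiv_class_eq[OF alg_cong_equiv[OF K[OF \<theta>]]] by (simp add: \<alpha>_def)
  then show False
    using iso xy alg_cong_carrier[OF K[OF \<theta>] xy(1)] by (auto simp: alg_iso_def bij_betw_def inj_on_def)
qed

section \<open>Congruences of lattice-ordered groups\<close>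

context lgroup
begin

section \<open>Order and lattice laws\<close>

abbreviation lg_le (infix "\<preceq>" 50) where "x \<preceq> y \<equiv> lle G x y"
abbreviation lg_join (infixl "\<curlyvee>" 65) where "x \<curlyvee> y \<equiv> ljoin G x y"
abbreviation lg_meet (infixl "\<curlywedge>" 70) where "x \<curlywedge> y \<equiv> lmeet G x y"

lemma le_refl [simp]: "x \<in> carrier G \<Longrightarrow> x \<preceq> x"
  and le_antisym: "x \<preceq> y \<Longrightarrow> y \<preceq> x \<Longrightarrow> x \<in> carrier G \<Longrightarrow> y \<in> carrier G \<Longrightarrow> x = y"
  and le_trans: "x \<preceq> y \<Longrightarrow> y \<preceq> z \<Longrightarrow> x \<in> carrier G \<Longrightarrow> y \<in> carrier G \<Longrightarrow> z \<in> carrier G \<Longrightarrow> x \<preceq> z"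
  and join_closed [simp]: "x \<in> carrier G \<Longrightarrow> y \<in> carrier G \<Longrightarrow> x \<curlyvee> y \<in> carrier G"
  and meet_closed [simp]: "x \<in> carrier G \<Longrightarrow> y \<in> carrier G \<Longrightarrow> x \<curlywedge> y \<in> carrier G"
  and join_upper1: "x \<in> carrier G \<Longrightarrow> y \<in> carrier G \<Longrightarrow> x \<preceq> x \<curlyvee> y"
  and join_upper2: "x \<in> carrier G \<Longrightarrow> y \<in> carrier G \<Longrightarrow> y \<preceq> x \<curlyvee> y"
  and join_least: "x \<preceq> z \<Longrightarrow> y \<preceq> z \<Longrightarrow> x \<in> carrier G \<Longrightarrow> y \<in> carrier G \<Longrightarrow> z \<in> carrier G \<Longrightarrow> x \<curlyvee> y \<preceq> z"
  and meet_lower1: "x \<in> carrier G \<Longrightarrow> y \<in> carrier G \<Longrightarrow> x \<curlywedge> y \<preceq> x"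
  and meet_lower2: "x \<in> carrier G \<Longrightarrow> y \<in> carrier G \<Longrightarrow> x \<curlywedge> y \<preceq> y"
  and meet_greatest: "z \<preceq> x \<Longrightarrow> z \<preceq> y \<Longrightarrow> x \<in> carrier G \<Longrightarrow> y \<in> carrier G \<Longrightarrow> z \<in> carrier G \<Longrightarrow> z \<preceq> x \<curlywedge> y"
proof -
  interpret L: lattice "lgroup_order G" by (rule lattice_order)
  have [simp]: "carrier (lgroup_order G) = carrier G" "le (lgroup_order G) = lle G"
    "eq (lgroup_order G) = (=)"
    by (simp_all add: lgroup_order_def)
  show "x \<in> carrier G \<Longrightarrow> x \<preceq> x" using L.le_refl by simp
  show "x \<preceq> y \<Longrightarrow> y \<preceq> x \<Longrightarrow> x \<in> carrier G \<Longrightarrow> y \<in> carrier G \<Longrightarrow> x = y"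
    using L.le_antisym by simp
  show "x \<preceq> y \<Longrightarrow> y \<preceq> z \<Longrightarrow> x \<in> carrier G \<Longrightarrow> y \<in> carrier G \<Longrightarrow> z \<in> carrier G \<Longrightarrow> x \<preceq> z"
    using L.le_trans by simp
  show "x \<in> carrier G \<Longrightarrow> y \<in> carrier G \<Longrightarrow> x \<curlyvee> y \<in> carrier G"
    using L.join_closed by (simp add: ljoin_def)
  show "x \<in> carrier G \<Longrightarrow> y \<in> carrier G \<Longrightarrow> x \<curlywedge> y \<in> carrier G"
    using L.meet_closed by (simp add: lmeet_def)
  show "x \<in> carrier G \<Longrightarrow> y \<in> carrier G \<Longrightarrow> x \<preceq> x \<curlyvee> y"
    using L.join_left by (simp add: ljoin_def)
  show "x \<in> carrier G \<Longrightarrow> y \<in> carrier G \<Longrightarrow> y \<preceq> x \<curlyvee> y"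
    using L.join_right by (simp add: ljoin_def)
  show "x \<preceq> z \<Longrightarrow> y \<preceq> z \<Longrightarrow> x \<in> carrier G \<Longrightarrow> y \<in> carrier G \<Longrightarrow> z \<in> carrier G \<Longrightarrow> x \<curlyvee> y \<preceq> z"
    using L.join_le by (simp add: ljoin_def)
  show "x \<in> carrier G \<Longrightarrow> y \<in> carrier G \<Longrightarrow> x \<curlywedge> y \<preceq> x"
    using L.meet_left by (simp add: lmeet_def)
  show "x \<in> carrier G \<Longrightarrow> y \<in> carrier G \<Longrightarrow> x \<curlywedge> y \<preceq> y"
    using L.meet_right by (simp add: lmeet_def)
  show "z \<preceq> x \<Longrightarrow> z \<preceq> y \<Longrightarrow> x \<in> carrier G \<Longrightarrow> y \<in> carrier G \<Longrightarrow> z \<in> carrier G \<Longrightarrow> z \<preceq> x \<curlywedge> y"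
    using L.meet_le by (simp add: lmeet_def)
qed

lemma join_eq_right: "x \<preceq> y \<Longrightarrow> x \<in> carrier G \<Longrightarrow> y \<in> carrier G \<Longrightarrow> x \<curlyvee> y = y"
  by (meson le_antisym join_closed join_least join_upper2 le_refl)

lemma join_eq_left: "y \<preceq> x \<Longrightarrow> x \<in> carrier G \<Longrightarrow> y \<in> carrier G \<Longrightarrow> x \<curlyvee> y = x"
  by (meson le_antisym join_closed join_least join_upper1 le_refl)

lemma meet_eq_left: "x \<preceq> y \<Longrightarrow> x \<in> carrier G \<Longrightarrow> y \<in> carrier G \<Longrightarrow> x \<curlywedge> y = x"
  by (meson le_antisym meet_closed meet_greatest meet_lower1 le_refl)

lemma meet_eq_left_iff: "x \<in> carrier G \<Longrightarrow> y \<in> carrier G \<Longrightarrow> x \<curlywedge> y = y \<longleftrightarrow> y \<preceq> x"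
  by (metis le_antisym meet_closed meet_greatest meet_lower1 meet_lower2 le_refl)

lemma mult_mono:
  assumes "x \<preceq> y" "x' \<preceq> y'" "x \<in> carrier G" "y \<in> carrier G" "x' \<in> carrier G" "y' \<in> carrier G"
  shows "x \<otimes> x' \<preceq> y \<otimes> y'"
proof -
  have "x \<otimes> x' \<preceq> y \<otimes> x'" using translation_mono[of x y \<one> x'] assms by simp
  moreover have "y \<otimes> x' \<preceq> y \<otimes> y'" using translation_mono[of x' y' y \<one>] assms by simp
  ultimately show ?thesis using le_trans assms by (meson m_closed)
qed

lemma le_mult_iff:
  assumes "u \<in> carrier G" "x \<in> carrier G" "y \<in> carrier G"
  shows "u \<otimes> x \<preceq> y \<longleftrightarrow> x \<preceq> inv u \<otimes> y"
proof
  assume "u \<otimes> x \<preceq> y"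
  then have "inv u \<otimes> (u \<otimes> x) \<preceq> inv u \<otimes> y" using assms by (intro mult_mono) auto
  then show "x \<preceq> inv u \<otimes> y" using assms by (simp add: m_assoc[symmetric])
next
  assume "x \<preceq> inv u \<otimes> y"
  then have "u \<otimes> x \<preceq> u \<otimes> (inv u \<otimes> y)" using assms by (intro mult_mono) auto
  then show "u \<otimes> x \<preceq> y" using assms by (simp add: m_assoc[symmetric])
qed

text \<open>Divisions in the kite have entries of this truncated form; whether such an entry is
  \<open>\<one>\<close> decides a comparison.\<close>

lemma inv_mult_meet_one_eq_iff:
  assumes "x \<in> carrier G" "y \<in> carrier G"
  shows "inv x \<otimes> y \<curlywedge> \<one> = \<one> \<longleftrightarrow> x \<preceq> y"
  using assms le_mult_iff[of x \<one> y] by (simp add: meet_eq_left_iff)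

lemma inv_antimono:
  assumes "x \<preceq> y" "x \<in> carrier G" "y \<in> carrier G"
  shows "inv y \<preceq> inv x"
  using translation_mono[of x y "inv x" "inv y"] assms by (simp add: m_assoc)

section \<open>Positive and negative cones\<close>

lemma neg_cone_iff: "x \<in> neg_cone G \<longleftrightarrow> x \<in> carrier G \<and> x \<preceq> \<one>"
  by (simp add: neg_cone_def)

lemma pos_cone_iff: "x \<in> pos_cone G \<longleftrightarrow> x \<in> carrier G \<and> \<one> \<preceq> x"
  by (simp add: pos_cone_def)

lemma one_neg [simp]: "\<one> \<in> neg_cone G" and one_pos [simp]: "\<one> \<in> pos_cone G"
  by (simp_all add: neg_cone_iff pos_cone_iff)

lemma inv_neg: "x \<in> neg_cone G \<Longrightarrow> inv x \<in> pos_cone G"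
  using inv_antimono[of x \<one>] by (auto simp: neg_cone_iff pos_cone_iff)

lemma inv_pos: "x \<in> pos_cone G \<Longrightarrow> inv x \<in> neg_cone G"
  using inv_antimono[of \<one> x] by (auto simp: neg_cone_iff pos_cone_iff)

lemma mult_neg: "x \<in> neg_cone G \<Longrightarrow> y \<in> neg_cone G \<Longrightarrow> x \<otimes> y \<in> neg_cone G"
  using mult_mono[of x \<one> y \<one>] by (auto simp: neg_cone_iff)

lemma mult_pos: "x \<in> pos_cone G \<Longrightarrow> y \<in> pos_cone G \<Longrightarrow> x \<otimes> y \<in> pos_cone G"
  using mult_mono[of \<one> x \<one> y] by (auto simp: pos_cone_iff)

lemma join_pos: "x \<in> carrier G \<Longrightarrow> y \<in> pos_cone G \<Longrightarrow> x \<curlyvee> y \<in> pos_cone G"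
  unfolding pos_cone_iff by (meson join_closed join_upper2 le_trans one_closed)

lemma meet_pos: "x \<in> pos_cone G \<Longrightarrow> y \<in> pos_cone G \<Longrightarrow> x \<curlywedge> y \<in> pos_cone G"
  by (simp add: pos_cone_iff meet_greatest)

lemma meet_neg: "x \<in> carrier G \<Longrightarrow> y \<in> neg_cone G \<Longrightarrow> x \<curlywedge> y \<in> neg_cone G"
  unfolding neg_cone_iff by (meson meet_closed meet_lower2 le_trans one_closed)

lemma join_neg: "x \<in> neg_cone G \<Longrightarrow> y \<in> neg_cone G \<Longrightarrow> x \<curlyvee> y \<in> neg_cone G"
  by (simp add: neg_cone_iff join_least)

lemma neg_coneD: "x \<in> neg_cone G \<Longrightarrow> x \<in> carrier G"
  and pos_coneD: "x \<in> pos_cone G \<Longrightarrow> x \<in> carrier G"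
  by (simp_all add: neg_cone_iff pos_cone_iff)

lemma lgroup_is_algebra: "is_algebra lgroup_ar (lgroup_alg G)"
  unfolding is_algebra_def
proof (intro conjI allI impI)
  show "carrier (lgroup_alg G) \<noteq> {}" by (auto simp: lgroup_alg_def)
  fix f xs assume "length xs = lgroup_ar f \<and> set xs \<subseteq> carrier (lgroup_alg G)"
  then show "op (lgroup_alg G) f xs \<in> carrier (lgroup_alg G)"
    by (cases f) (auto simp: lgroup_alg_def numeral_2_eq_2 length_Suc_conv)
qed

section \<open>Congruences and normal filters of the negative cone\<close>

abbreviation lg_cong where "lg_cong \<equiv> alg_cong lgroup_ar (lgroup_alg G)"

lemma lg_congI:
  assumes "equiv (carrier G) \<phi>"
    and "\<And>x y x' y'. (x, y) \<in> \<phi> \<Longrightarrow> (x', y') \<in> \<phi> \<Longrightarrow> (x \<curlyvee> x', y \<curlyvee> y') \<in> \<phi>"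
    and "\<And>x y x' y'. (x, y) \<in> \<phi> \<Longrightarrow> (x', y') \<in> \<phi> \<Longrightarrow> (x \<curlywedge> x', y \<curlywedge> y') \<in> \<phi>"
    and "\<And>x y x' y'. (x, y) \<in> \<phi> \<Longrightarrow> (x', y') \<in> \<phi> \<Longrightarrow> (x \<otimes> x', y \<otimes> y') \<in> \<phi>"
    and "\<And>x y. (x, y) \<in> \<phi> \<Longrightarrow> (inv x, inv y) \<in> \<phi>"
  shows "lg_cong \<phi>"
  unfolding alg_cong_def
proof (intro conjI allI impI)
  show "equiv (carrier (lgroup_alg G)) \<phi>" using assms(1) by (simp add: lgroup_alg_def)
  have one: "(\<one>, \<one>) \<in> \<phi>" using assms(1) by (auto simp: equiv_def refl_on_def)
  fix f xs ys
  assume "length xs = lgroup_ar f \<and> list_all2 (\<lambda>x y. (x, y) \<in> \<phi>) xs ys"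
  then show "(op (lgroup_alg G) f xs, op (lgroup_alg G) f ys) \<in> \<phi>"
    using one assms(2-5)
    by (cases f) (auto simp: lgroup_alg_def numeral_2_eq_2 length_Suc_conv list_all2_Cons1)
qed

lemma lg_cong_refl: "lg_cong \<phi> \<Longrightarrow> x \<in> carrier G \<Longrightarrow> (x, x) \<in> \<phi>"
  using alg_cong_refl[of lgroup_ar "lgroup_alg G"] by (simp add: lgroup_alg_def)

lemma lg_cong_carrier: 
  assumes "lg_cong \<phi>" "(x, y) \<in> \<phi>"
  shows "x \<in> carrier G" "y \<in> carrier G"
  using alg_cong_carrier[OF assms] by (simp_all add: lgroup_alg_def)

lemma lg_cong_ops:
  assumes "lg_cong \<phi>" "(x, y) \<in> \<phi>"
  shows "(inv x, inv y) \<in> \<phi>"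
    and "(x', y') \<in> \<phi> \<Longrightarrow> (x \<curlyvee> x', y \<curlyvee> y') \<in> \<phi>"
    and "(x', y') \<in> \<phi> \<Longrightarrow> (x \<curlywedge> x', y \<curlywedge> y') \<in> \<phi>"
    and "(x', y') \<in> \<phi> \<Longrightarrow> (x \<otimes> x', y \<otimes> y') \<in> \<phi>"
  using alg_cong_op1[OF assms(1) _ assms(2), of GInv] alg_cong_op2[OF assms(1) _ assms(2), of GJoin x' y']
    alg_cong_op2[OF assms(1) _ assms(2), of GMeet x' y'] alg_cong_op2[OF assms(1) _ assms(2), of GMult x' y']
  by (simp_all add: lgroup_alg_def)

lemma lg_cong_Id: "lg_cong (Id_on (carrier G))"
  by (rule lg_congI) (auto simp: equiv_def refl_on_def sym_def trans_def)

lemma lg_cong_full: "lg_cong (carrier G \<times> carrier G)"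
  by (rule lg_congI) (auto simp: equiv_def refl_on_def sym_def trans_def)

text \<open>Turns an identified pair into a negative element identified with \<open>\<one>\<close>.
  The element depends on \<open>a\<close> and \<open>b\<close> only, so one choice serves all
  congruences containing the pair.\<close>

lemma lg_cong_witness:
  assumes "a \<in> carrier G" "b \<in> carrier G" "a \<noteq> b"
  obtains c where "c \<in> neg_cone G" "c \<noteq> \<one>" "\<And>\<phi>. lg_cong \<phi> \<Longrightarrow> (a, b) \<in> \<phi> \<Longrightarrow> (c, \<one>) \<in> \<phi>"
proof -
  define g where "g = a \<otimes> inv b"
  have g: "g \<in> carrier G" "g \<noteq> \<one>"
    using assms inv_equality[of a "inv b"] by (auto simp: g_def)
  have rel: "(g, \<one>) \<in> \<phi>" if \<phi>: "lg_cong \<phi>" "(a, b) \<in> \<phi>" for \<phi>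
    using lg_cong_ops(4)[OF \<phi> lg_cong_refl[OF \<phi>(1)], of "inv b"] assms by (simp add: g_def)
  show thesis
  \<comment> \<open>A positive \<open>g\<close> is inverted. Otherwise
    \<open>g \<curlywedge> \<one>\<close> differs from \<open>\<one>\<close>, since equality would
    mean \<open>\<one> \<preceq> g\<close>.\<close>
  proof (cases "\<one> \<preceq> g")
    case True
    then have "inv g \<in> neg_cone G" "inv g \<noteq> \<one>"
      using g inv_pos[of g] by (auto simp: pos_cone_iff)
    then show thesis using that[of "inv g"] lg_cong_ops(1)[OF _ rel] by auto
  next
    case False
    then have "g \<curlywedge> \<one> \<in> neg_cone G" "g \<curlywedge> \<one> \<noteq> \<one>"
      using g meet_neg[of g \<one>] meet_eq_left_iff[of g \<one>] by auto
    then show thesis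
      using that[of "g \<curlywedge> \<one>"] lg_cong_ops(3)[OF _ rel lg_cong_refl[of _ \<one>]] meet_eq_left[of \<one> \<one>]
      by auto
  qed
qed

text \<open>A normal filter of the negative cone is the negative part of a convex normal subgroup
  closed under the lattice operations; the congruence has its cosets as classes.\<close>

lemma lg_cong_of_filter:
  assumes N: "N \<subseteq> neg_cone G" and one: "\<one> \<in> N"
    and mult: "\<And>x y. x \<in> N \<Longrightarrow> y \<in> N \<Longrightarrow> x \<otimes> y \<in> N"
    and up: "\<And>x y. x \<in> N \<Longrightarrow> y \<in> neg_cone G \<Longrightarrow> x \<preceq> y \<Longrightarrow> y \<in> N"
    and conj: "\<And>x u. x \<in> N \<Longrightarrow> u \<in> carrier G \<Longrightarrow> u \<otimes> x \<otimes> inv u \<in> N"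
  obtains \<phi> where "lg_cong \<phi>" "\<And>x. x \<in> neg_cone G \<Longrightarrow> (x, \<one>) \<in> \<phi> \<longleftrightarrow> x \<in> N"
proof -
  \<comment> \<open>\<open>R x y\<close> is the order of the quotient: \<open>x\<close> lies above
    \<open>y\<close> up to a factor from \<open>N\<close>. The congruence is its symmetric
    part.\<close>
  define R where "R x y \<longleftrightarrow> (\<exists>n\<in>N. n \<otimes> y \<preceq> x)" for x y
  define \<phi> where "\<phi> = {(x, y). x \<in> carrier G \<and> y \<in> carrier G \<and> R x y \<and> R y x}"
  have NC: "n \<in> carrier G" "n \<preceq> \<one>" if "n \<in> N" for n using that N by (auto simp: neg_cone_iff)
  have lower: "n \<otimes> y \<preceq> y" if "n \<in> N" "y \<in> carrier G" for n y
    using mult_mono[of n \<one> y y] NC[OF that(1)] that by simp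
  have Rrefl: "R x x" if "x \<in> carrier G" for x
    using one that by (auto simp: R_def intro!: bexI[of _ \<one>])
  have Rtrans: "R x z" if R: "R x y" "R y z" and C: "x \<in> carrier G" "y \<in> carrier G" "z \<in> carrier G" for x y z
  proof -
    obtain n m where nm: "n \<in> N" "m \<in> N" "n \<otimes> y \<preceq> x" "m \<otimes> z \<preceq> y" using R by (auto simp: R_def)
    have "n \<otimes> m \<otimes> z \<preceq> n \<otimes> y" using nm C NC mult_mono[of n n "m \<otimes> z" y] by (simp add: m_assoc)
    then have "n \<otimes> m \<otimes> z \<preceq> x" using nm C NC le_trans[of "n \<otimes> m \<otimes> z" "n \<otimes> y" x] by simp
    then show ?thesis using mult nm by (auto simp: R_def)
  qed
  have Rinv: "R (inv y) (inv x)" if R: "R x y" and C: "x \<in> carrier G" "y \<in> carrier G" for x y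
  proof -
    obtain n where n: "n \<in> N" "n \<otimes> y \<preceq> x" using R by (auto simp: R_def)
    \<comment> \<open>The factor \<open>n\<close> ends up to the right of \<open>inv x\<close>;
      normality brings it back to the left as a conjugate.\<close>
    have "inv x \<otimes> (n \<otimes> y) \<otimes> inv y \<preceq> inv x \<otimes> x \<otimes> inv y"
      using n C NC translation_mono[of "n \<otimes> y" x "inv x" "inv y"] by simp
    then have "(inv x \<otimes> n \<otimes> inv (inv x)) \<otimes> inv x \<preceq> inv y" using n C NC by (simp add: m_assoc)
    then show ?thesis using conj[of n "inv x"] n C by (auto simp: R_def)
  qed
  have Rmult: "R (x \<otimes> x') (y \<otimes> y')" if R: "R x y" "R x' y'"
    and C: "x \<in> carrier G" "y \<in> carrier G" "x' \<in> carrier G" "y' \<in> carrier G" for x y x' y'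
  proof -
    obtain n m where nm: "n \<in> N" "m \<in> N" "n \<otimes> y \<preceq> x" "m \<otimes> y' \<preceq> x'" using R by (auto simp: R_def)
    have "(n \<otimes> y) \<otimes> (m \<otimes> y') \<preceq> x \<otimes> x'" using nm C NC by (intro mult_mono) auto
    \<comment> \<open>To collect both factors on the left, \<open>m\<close> is moved past
      \<open>y\<close> at the price of a conjugation by \<open>y\<close>.\<close>
    moreover have "(n \<otimes> (y \<otimes> m \<otimes> inv y)) \<otimes> (y \<otimes> y') = (n \<otimes> y) \<otimes> (m \<otimes> (inv y \<otimes> y) \<otimes> y')"
      using nm C NC by (simp only: m_assoc m_closed inv_closed)
    ultimately have "(n \<otimes> (y \<otimes> m \<otimes> inv y)) \<otimes> (y \<otimes> y') \<preceq> x \<otimes> x'" using nm C NC by simp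
    then show ?thesis using mult[OF nm(1) conj[OF nm(2) C(2)]] by (auto simp: R_def)
  qed
  \<comment> \<open>Both factors are negative, so \<open>n \<otimes> m\<close> lies below each of
    them and serves both inequalities. Joins and meets require such a common factor.\<close>
  have Rcommon: "\<exists>n\<in>N. n \<otimes> y \<preceq> x \<and> n \<otimes> y' \<preceq> x'" if R: "R x y" "R x' y'"
    and C: "x \<in> carrier G" "y \<in> carrier G" "x' \<in> carrier G" "y' \<in> carrier G" for x y x' y'
  proof -
    obtain n m where nm: "n \<in> N" "m \<in> N" "n \<otimes> y \<preceq> x" "m \<otimes> y' \<preceq> x'" using R by (auto simp: R_def)
    have "n \<otimes> m \<preceq> n" "n \<otimes> m \<preceq> m"
      using mult_mono[of n n m \<one>] mult_mono[of n \<one> m m] nm NC by auto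
    then have "n \<otimes> m \<otimes> y \<preceq> n \<otimes> y" "n \<otimes> m \<otimes> y' \<preceq> m \<otimes> y'"
      using mult_mono[of "n \<otimes> m" n y y] mult_mono[of "n \<otimes> m" m y' y'] nm NC C by auto
    then have "n \<otimes> m \<otimes> y \<preceq> x" "n \<otimes> m \<otimes> y' \<preceq> x'"
      using nm NC C le_trans[of "n \<otimes> m \<otimes> y" "n \<otimes> y" x] le_trans[of "n \<otimes> m \<otimes> y'" "m \<otimes> y'" x'] by auto
    then show ?thesis using mult nm by blast
  qed
  have Rjoin: "R (x \<curlyvee> x') (y \<curlyvee> y')" if R: "R x y" "R x' y'"
    and C: "x \<in> carrier G" "y \<in> carrier G" "x' \<in> carrier G" "y' \<in> carrier G" for x y x' y'
  proof -
    obtain n where n: "n \<in> N" "n \<otimes> y \<preceq> x" "n \<otimes> y' \<preceq> x'" using Rcommon[OF R C] by blast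
    have "n \<otimes> y \<preceq> x \<curlyvee> x'" "n \<otimes> y' \<preceq> x \<curlyvee> x'"
      using n C NC join_upper1[of x x'] join_upper2[of x x']
        le_trans[of "n \<otimes> y" x "x \<curlyvee> x'"] le_trans[of "n \<otimes> y'" x' "x \<curlyvee> x'"] by auto
    \<comment> \<open>\<open>n\<close> is shifted to the right-hand side, where the universal
      property of the join applies directly.\<close>
    then have "n \<otimes> (y \<curlyvee> y') \<preceq> x \<curlyvee> x'"
      using n C NC join_least[of y "inv n \<otimes> (x \<curlyvee> x')" y'] by (simp add: le_mult_iff)
    then show ?thesis using n by (auto simp: R_def)
  qed
  have Rmeet: "R (x \<curlywedge> x') (y \<curlywedge> y')" if R: "R x y" "R x' y'"
    and C: "x \<in> carrier G" "y \<in> carrier G" "x' \<in> carrier G" "y' \<in> carrier G" for x y x' y'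
  proof -
    obtain n where n: "n \<in> N" "n \<otimes> y \<preceq> x" "n \<otimes> y' \<preceq> x'" using Rcommon[OF R C] by blast
    have "n \<otimes> (y \<curlywedge> y') \<preceq> n \<otimes> y" "n \<otimes> (y \<curlywedge> y') \<preceq> n \<otimes> y'"
      using n C NC mult_mono[of n n "y \<curlywedge> y'"] meet_lower1 meet_lower2 by auto
    then have "n \<otimes> (y \<curlywedge> y') \<preceq> x" "n \<otimes> (y \<curlywedge> y') \<preceq> x'"
      using n C NC le_trans[of "n \<otimes> (y \<curlywedge> y')" "n \<otimes> y" x] le_trans[of "n \<otimes> (y \<curlywedge> y')" "n \<otimes> y'" x'] by auto
    then show ?thesis using n C NC meet_greatest[of "n \<otimes> (y \<curlywedge> y')" x x'] by (auto simp: R_def)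
  qed
  have "equiv (carrier G) \<phi>"
    using Rrefl Rtrans by (auto simp: equiv_def refl_on_def sym_def trans_def \<phi>_def)
  then have "lg_cong \<phi>"
    by (rule lg_congI) (auto simp: \<phi>_def Rinv Rmult Rjoin Rmeet)
  moreover have "(x, \<one>) \<in> \<phi> \<longleftrightarrow> x \<in> N" if x: "x \<in> neg_cone G" for x
  proof
    assume "(x, \<one>) \<in> \<phi>"
    then obtain n where "n \<in> N" "n \<otimes> \<one> \<preceq> x" by (auto simp: \<phi>_def R_def)
    then show "x \<in> N" using up[of n x] NC x by simp
  next
    assume "x \<in> N"
    \<comment> \<open>The factor \<open>x\<close> itself witnesses \<open>R x \<one>\<close>, and
      the factor \<open>\<one>\<close> witnesses \<open>R \<one> x\<close>.\<close>
    then show "(x, \<one>) \<in> \<phi>"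
      using one NC[of x] le_refl[of x] by (auto simp: \<phi>_def R_def intro: bexI[of _ x] bexI[of _ \<one>])
  qed
  ultimately show thesis using that by blast
qed

end

section \<open>Congruences of kites\<close>

text \<open>For trivial \<open>G\<close> or empty \<open>I\<close> the kite has just two elements
  and is subdirectly irreducible, whereas \<open>G\<close> need not be. The last two assumptions
  exclude this and provide an index \<open>i\<close> and an entry \<open>c \<noteq> \<one>\<close>
  to work with.\<close>

locale kite_frame = lgroup G for G :: "('a, 'm) lgroup_scheme" (structure) +
  fixes I :: "'i set" and J :: "'j set" and lam rho :: "'j \<Rightarrow> 'i"
  assumes lam_closed: "lam \<in> J \<rightarrow> I" and lam_inj: "inj_on lam J"
    and rho_closed: "rho \<in> J \<rightarrow> I" and rho_inj: "inj_on rho J"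
    and nontrivial: "carrier G \<noteq> {\<one>}" and index_nonempty: "I \<noteq> {}"
begin

section \<open>Closure of the kite operations and a criterion for congruences\<close>

abbreviation "K \<equiv> kite G I J lam rho"
abbreviation "k_join \<equiv> kite_join G I J"
abbreviation "k_meet \<equiv> kite_meet G I J"
abbreviation "k_mult \<equiv> kite_mult G I J lam rho"
abbreviation "k_ldiv \<equiv> kite_ldiv G I J lam rho"
abbreviation "k_rdiv \<equiv> kite_rdiv G I J lam rho"
abbreviation "k_one \<equiv> kite_one G I :: ('a, 'i, 'j) kite_elt"
abbreviation "k_zero \<equiv> kite_zero G J :: ('a, 'i, 'j) kite_elt"
abbreviation "k_cong \<equiv> alg_cong kite_ar K"

lemma lam_in [simp]: "j \<in> J \<Longrightarrow> lam j \<in> I" and rho_in [simp]: "j \<in> J \<Longrightarrow> rho j \<in> I"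
  using lam_closed rho_closed by auto

lemma kite_carrier_simps [simp]:
  "Inl f \<in> carrier K \<longleftrightarrow> f \<in> J \<rightarrow>\<^sub>E pos_cone G"
  "Inr x \<in> carrier K \<longleftrightarrow> x \<in> I \<rightarrow>\<^sub>E neg_cone G"
  by (auto simp: kite_def kite_carrier_def)

lemma seq_carrier:
  "f \<in> J \<rightarrow>\<^sub>E pos_cone G \<Longrightarrow> j \<in> J \<Longrightarrow> f j \<in> carrier G"
  "x \<in> I \<rightarrow>\<^sub>E neg_cone G \<Longrightarrow> i \<in> I \<Longrightarrow> x i \<in> carrier G"
  by (auto dest: PiE_mem pos_coneD neg_coneD)

lemma one_in_kite [simp]: "k_one \<in> carrier K" and zero_in_kite [simp]: "k_zero \<in> carrier K"
  by (simp_all add: kite_one_def kite_zero_def)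

lemma kite_join_closed: "u \<in> carrier K \<Longrightarrow> v \<in> carrier K \<Longrightarrow> k_join u v \<in> carrier K"
  by (cases u; cases v) (auto intro!: join_pos join_neg simp: seq_carrier)

lemma kite_meet_closed: "u \<in> carrier K \<Longrightarrow> v \<in> carrier K \<Longrightarrow> k_meet u v \<in> carrier K"
  by (cases u; cases v) (auto intro!: meet_pos meet_neg simp: seq_carrier)

lemma kite_mult_closed: "u \<in> carrier K \<Longrightarrow> v \<in> carrier K \<Longrightarrow> k_mult u v \<in> carrier K"
  by (cases u; cases v)
    (auto intro!: join_pos mult_neg simp: seq_carrier)

lemma kite_ldiv_closed: "u \<in> carrier K \<Longrightarrow> v \<in> carrier K \<Longrightarrow> k_ldiv u v \<in> carrier K"
  by (cases u; cases v)
    (auto intro!: meet_neg mult_pos inv_neg simp: seq_carrier the_inv_into_f_f[OF rho_inj])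

lemma kite_rdiv_closed: "u \<in> carrier K \<Longrightarrow> v \<in> carrier K \<Longrightarrow> k_rdiv u v \<in> carrier K"
  by (cases u; cases v)
    (auto intro!: meet_neg mult_pos inv_neg simp: seq_carrier the_inv_into_f_f[OF lam_inj])

lemmas kite_closed = kite_join_closed kite_meet_closed kite_mult_closed kite_ldiv_closed kite_rdiv_closed

lemma kite_is_algebra: "is_algebra kite_ar K"
  unfolding is_algebra_def
proof (intro conjI allI impI)
  show "carrier K \<noteq> {}" using one_in_kite by blast
  fix f us assume "length us = kite_ar f \<and> set us \<subseteq> carrier K"
  moreover have "op K KJoin [u, v] = k_join u v" "op K KMeet [u, v] = k_meet u v"
    "op K KMult [u, v] = k_mult u v" "op K KLdiv [u, v] = k_ldiv u v"
    "op K KRdiv [u, v] = k_rdiv u v" "op K KOne [] = k_one" "op K KZero [] = k_zero" for u v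
    by (simp_all add: kite_def)
  ultimately show "op K f us \<in> carrier K"
    by (cases f) (auto simp: numeral_2_eq_2 length_Suc_conv kite_closed simp del: kite_carrier_simps)
qed

lemma kite_congI:
  assumes "equiv (carrier K) \<theta>"
    and "\<And>u v u' v'. (u, v) \<in> \<theta> \<Longrightarrow> (u', v') \<in> \<theta> \<Longrightarrow> (k_join u u', k_join v v') \<in> \<theta>"
    and "\<And>u v u' v'. (u, v) \<in> \<theta> \<Longrightarrow> (u', v') \<in> \<theta> \<Longrightarrow> (k_meet u u', k_meet v v') \<in> \<theta>"
    and "\<And>u v u' v'. (u, v) \<in> \<theta> \<Longrightarrow> (u', v') \<in> \<theta> \<Longrightarrow> (k_mult u u', k_mult v v') \<in> \<theta>"
    and "\<And>u v u' v'. (u, v) \<in> \<theta> \<Longrightarrow> (u', v') \<in> \<theta> \<Longrightarrow> (k_ldiv u u', k_ldiv v v') \<in> \<theta>"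
    and "\<And>u v u' v'. (u, v) \<in> \<theta> \<Longrightarrow> (u', v') \<in> \<theta> \<Longrightarrow> (k_rdiv u u', k_rdiv v v') \<in> \<theta>"
  shows "k_cong \<theta>"
  unfolding alg_cong_def
proof (intro conjI allI impI)
  show "equiv (carrier K) \<theta>" by (rule assms(1))
  then have const: "(k_one, k_one) \<in> \<theta>" "(k_zero, k_zero) \<in> \<theta>"
    by (auto simp: equiv_def refl_on_def)
  fix f us vs
  assume "length us = kite_ar f \<and> list_all2 (\<lambda>u v. (u, v) \<in> \<theta>) us vs"
  then show "(op K f us, op K f vs) \<in> \<theta>"
    using const assms(2-6)
    by (cases f) (auto simp: kite_def numeral_2_eq_2 length_Suc_conv list_all2_Cons1)
qed

lemma kite_cong_ops:
  assumes "k_cong \<theta>" "(u, v) \<in> \<theta>" "(u', v') \<in> \<theta>"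
  shows "(k_join u u', k_join v v') \<in> \<theta>"
    and "(k_mult u u', k_mult v v') \<in> \<theta>"
    and "(k_ldiv u u', k_ldiv v v') \<in> \<theta>"
    and "(k_rdiv u u', k_rdiv v v') \<in> \<theta>"
  using alg_cong_op2[OF assms(1) _ assms(2,3), of KJoin] alg_cong_op2[OF assms(1) _ assms(2,3), of KMult]
    alg_cong_op2[OF assms(1) _ assms(2,3), of KLdiv] alg_cong_op2[OF assms(1) _ assms(2,3), of KRdiv]
  by (simp_all add: kite_def)

text \<open>A coordinate \<open>j\<close> of the lower part is compared by the congruence at
  \<open>lam j\<close>. In the families considered \<open>\<phi> (lam j) = \<phi> (rho j)\<close>,
  so the choice of side is immaterial. Elements of different parts are never related.\<close>

fun coord_rel :: "('i \<Rightarrow> ('a \<times> 'a) set) \<Rightarrow> ('a, 'i, 'j) kite_elt \<Rightarrow> ('a, 'i, 'j) kite_elt \<Rightarrow> bool" where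
  "coord_rel \<phi> (Inl f) (Inl g) \<longleftrightarrow> (\<forall>j\<in>J. (f j, g j) \<in> \<phi> (lam j))"
| "coord_rel \<phi> (Inr x) (Inr y) \<longleftrightarrow> (\<forall>i\<in>I. (x i, y i) \<in> \<phi> i)"
| "coord_rel \<phi> _ _ \<longleftrightarrow> False"

definition coord_cong :: "('i \<Rightarrow> ('a \<times> 'a) set) \<Rightarrow> (('a, 'i, 'j) kite_elt \<times> ('a, 'i, 'j) kite_elt) set" where
  "coord_cong \<phi> = {(u, v). u \<in> carrier K \<and> v \<in> carrier K \<and> coord_rel \<phi> u v}"

text \<open>A mixed operation combines coordinate \<open>j\<close> of the lower part with coordinate
  \<open>lam j\<close> or \<open>rho j\<close> of the upper part, and dividing two lower elements
  puts coordinate \<open>j\<close> at one of these two places. Equality of \<open>\<phi>\<close> at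
  both makes every operation compatible.\<close>

lemma coord_cong_kite_cong:
  assumes \<phi>: "\<And>i. i \<in> I \<Longrightarrow> lg_cong (\<phi> i)" and glue: "\<And>j. j \<in> J \<Longrightarrow> \<phi> (lam j) = \<phi> (rho j)"
  shows "k_cong (coord_cong \<phi>)"
proof -
  note ops = lg_cong_ops[OF \<phi>]
  have one: "(\<one>, \<one>) \<in> \<phi> i" if "i \<in> I" for i using lg_cong_refl[OF \<phi>] that by simp
  have inv_rho: "the_inv_into J rho (rho j) = j" and inv_lam: "the_inv_into J lam (lam j) = j"
    if "j \<in> J" for j
    using that by (simp_all add: the_inv_into_f_f[OF rho_inj] the_inv_into_f_f[OF lam_inj])
  have refl: "coord_rel \<phi> u u" if "u \<in> carrier K" for u
    using that by (cases u) (auto intro!: lg_cong_refl[OF \<phi>] simp: seq_carrier)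
  have sym: "coord_rel \<phi> v u" if "coord_rel \<phi> u v" for u v
    using that by (cases u; cases v) (auto intro: alg_cong_sym[OF \<phi>])
  have trans: "coord_rel \<phi> u w" if "coord_rel \<phi> u v" "coord_rel \<phi> v w" for u v w
    using that by (cases u; cases v; cases w) (auto intro: alg_cong_trans[OF \<phi>])
  have "equiv (carrier K) (coord_cong \<phi>)"
    unfolding equiv_def refl_on_def sym_def trans_def coord_cong_def
    using refl sym trans by blast
  moreover have "coord_rel \<phi> (k_join u u') (k_join v v')"
    if "coord_rel \<phi> u v" "coord_rel \<phi> u' v'" for u v u' v'
    using that by (cases u; cases v; cases u'; cases v') (auto intro!: ops)
  moreover have "coord_rel \<phi> (k_meet u u') (k_meet v v')"
    if "coord_rel \<phi> u v" "coord_rel \<phi> u' v'" for u v u' v'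
    using that by (cases u; cases v; cases u'; cases v') (auto intro!: ops)
  moreover have "coord_rel \<phi> (k_mult u u') (k_mult v v')"
    if "coord_rel \<phi> u v" "coord_rel \<phi> u' v'" for u v u' v'
    using that
    by (cases u; cases v; cases u'; cases v') (auto intro!: ops one simp: kite_zero_def, simp_all add: glue)
  \<comment> \<open>For two lower elements the entry computed at \<open>j\<close> is placed at
    \<open>rho j\<close>, while its arguments are compared at \<open>lam j\<close>; hence
    \<open>glue\<close> from right to left.\<close>
  moreover have "coord_rel \<phi> (k_ldiv u u') (k_ldiv v v')"
    if "coord_rel \<phi> u v" "coord_rel \<phi> u' v'" for u v u' v'
    using that
    by (cases u; cases v; cases u'; cases v')
      (auto intro!: ops one simp: kite_one_def glue[symmetric] inv_rho)
  moreover have "coord_rel \<phi> (k_rdiv u u') (k_rdiv v v')"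
    if "coord_rel \<phi> u v" "coord_rel \<phi> u' v'" for u v u' v'
    using that
    by (cases u; cases v; cases u'; cases v') (auto intro!: ops one simp: kite_one_def glue inv_lam)
  ultimately show ?thesis
    by (intro kite_congI) (auto simp: coord_cong_def kite_closed simp del: kite_carrier_simps)
qed

section \<open>Elements supported at one index as test elements for congruences\<close>

definition single :: "'i \<Rightarrow> 'a \<Rightarrow> ('a, 'i, 'j) kite_elt" where
  "single i c = Inr (\<lambda>k\<in>I. if k = i then c else \<one>)"

lemma single_in_kite: "c \<in> neg_cone G \<Longrightarrow> single i c \<in> carrier K"
  by (auto simp: single_def)

lemma single_one: "single i \<one> = k_one"
  by (auto simp: single_def kite_one_def)

lemma single_neq_one: "i \<in> I \<Longrightarrow> c \<noteq> \<one> \<Longrightarrow> single i c \<noteq> k_one"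
  by (auto simp: single_def kite_one_def fun_eq_iff)

lemma coord_cong_single:
  assumes "i \<in> I" "c \<in> neg_cone G" "\<And>k. k \<in> I \<Longrightarrow> lg_cong (\<phi> k)"
  shows "(single i c, k_one) \<in> coord_cong \<phi> \<longleftrightarrow> (c, \<one>) \<in> \<phi> i"
  using assms by (auto simp: coord_cong_def single_def kite_one_def lg_cong_refl)

lemma kite_ldiv_self: "u \<in> carrier K \<Longrightarrow> k_ldiv u u = k_one"
  by (cases u)
    (auto simp: kite_one_def fun_eq_iff seq_carrier meet_eq_left the_inv_into_f_f[OF rho_inj])

lemma kite_rdiv_self: "u \<in> carrier K \<Longrightarrow> k_rdiv u u = k_one"
  by (cases u)
    (auto simp: kite_one_def fun_eq_iff seq_carrier meet_eq_left the_inv_into_f_f[OF lam_inj])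

lemma kite_cong_ldiv:
  assumes "k_cong \<theta>" "(u, v) \<in> \<theta>"
  shows "(k_ldiv u v, k_one) \<in> \<theta>"
  using kite_cong_ops(3)[OF assms(1) alg_cong_refl[OF assms(1) alg_cong_carrier(1)[OF assms]]
      alg_cong_sym[OF assms]] kite_ldiv_self[OF alg_cong_carrier(1)[OF assms]] by simp

text \<open>Once a lower element is identified with an upper one, dividing by the latter identifies
  some lower element with \<open>1\<close>. Joining with \<open>Inr y\<close> turns the lower side
  into \<open>Inr y\<close> and leaves \<open>1\<close> as it is.\<close>

lemma kite_cong_collapse:
  assumes \<theta>: "k_cong \<theta>" and u: "(Inl f, Inr x) \<in> \<theta>" and y: "y \<in> I \<rightarrow>\<^sub>E neg_cone G"
  shows "(Inr y, k_one) \<in> \<theta>"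
proof -
  have "(k_ldiv (Inr x) (Inl f), k_one) \<in> \<theta>"
    by (rule kite_cong_ldiv[OF \<theta> alg_cong_sym[OF \<theta> u]])
  then have "(k_join (k_ldiv (Inr x) (Inl f)) (Inr y), k_join k_one (Inr y)) \<in> \<theta>"
    using y by (intro kite_cong_ops[OF \<theta>] alg_cong_refl[OF \<theta>]) auto
  moreover have "k_join k_one (Inr y) = k_one"
    using y by (auto simp: kite_one_def fun_eq_iff neg_cone_iff join_eq_left dest!: PiE_mem)
  ultimately show ?thesis by simp
qed

text \<open>All entries of \<open>x\<close> are at most \<open>\<one>\<close>, so the join with
  \<open>single i (x i)\<close> erases every coordinate of \<open>x\<close> except the one at
  \<open>i\<close>, while \<open>1\<close> absorbs it.\<close>

lemma kite_cong_coordinate: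
  assumes \<theta>: "k_cong \<theta>" and x: "(Inr x, k_one) \<in> \<theta>" and i: "i \<in> I"
  shows "(single i (x i), k_one) \<in> \<theta>"
proof -
  have xC: "x k \<in> carrier G" "x k \<preceq> \<one>" if "k \<in> I" for k
    using alg_cong_carrier[OF \<theta> x] that PiE_mem[of x I "\<lambda>_. neg_cone G" k] by (auto simp: neg_cone_iff)
  then have "(k_join (Inr x) (single i (x i)), k_join k_one (single i (x i))) \<in> \<theta>"
    using i by (intro kite_cong_ops[OF \<theta> x] alg_cong_refl[OF \<theta>] single_in_kite) (simp add: neg_cone_iff)
  moreover have "k_join (Inr x) (single i (x i)) = single i (x i)"
    "k_join k_one (single i (x i)) = k_one"
    using xC i by (auto simp: single_def kite_one_def fun_eq_iff join_eq_left join_eq_right)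
  ultimately show ?thesis by simp
qed

lemma exists_negative:
  obtains c where "c \<in> neg_cone G" "c \<noteq> \<one>"
proof -
  obtain g where "g \<in> carrier G" "g \<noteq> \<one>" using nontrivial one_closed by blast
  then show thesis using that lg_cong_witness[of g \<one>] by auto
qed

text \<open>At a coordinate where \<open>u\<close> and \<open>v\<close> differ, antisymmetry makes
  one of the two inequalities fail, and the corresponding division is not \<open>\<one>\<close>
  there. A difference at \<open>j\<close> in the lower part shows up at
  \<open>rho j\<close>.\<close>

lemma ldiv_nontrivial:
  assumes u: "u \<in> carrier K" and v: "v \<in> carrier K" and neq: "u \<noteq> v" and sort: "isl u = isl v"
  shows "\<exists>x. \<exists>i\<in>I. x i \<noteq> \<one> \<and> (k_ldiv u v = Inr x \<or> k_ldiv v u = Inr x)"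
proof (cases u)
  case (Inl f)
  then obtain g where g: "v = Inl g" using sort by (cases v) auto
  then obtain j where j: "j \<in> J" "f j \<noteq> g j"
    using u v neq Inl PiE_ext[of f J "\<lambda>_. pos_cone G" g] by auto
  have C: "f j \<in> carrier G" "g j \<in> carrier G" using u v Inl g j by (auto intro: seq_carrier)
  show ?thesis
  proof (cases "f j \<preceq> g j")
    case True
    then have "\<not> g j \<preceq> f j" using le_antisym C j by blast
    then have "\<exists>x. k_ldiv v u = Inr x \<and> x (rho j) \<noteq> \<one>"
      using j C by (simp add: Inl g the_inv_into_f_f[OF rho_inj] inv_mult_meet_one_eq_iff)
    then show ?thesis using rho_in[OF j(1)] by blast
  next
    case False
    then have "\<exists>x. k_ldiv u v = Inr x \<and> x (rho j) \<noteq> \<one>"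
      using j C by (simp add: Inl g the_inv_into_f_f[OF rho_inj] inv_mult_meet_one_eq_iff)
    then show ?thesis using rho_in[OF j(1)] by blast
  qed
next
  case (Inr x)
  then obtain y where y: "v = Inr y" using sort by (cases v) auto
  then obtain i where i: "i \<in> I" "x i \<noteq> y i"
    using u v neq Inr PiE_ext[of x I "\<lambda>_. neg_cone G" y] by auto
  have C: "x i \<in> carrier G" "y i \<in> carrier G" using u v Inr y i by (auto intro: seq_carrier)
  show ?thesis
  proof (cases "x i \<preceq> y i")
    case True
    then have "\<not> y i \<preceq> x i" using le_antisym C i by blast
    then have "\<exists>z. k_ldiv v u = Inr z \<and> z i \<noteq> \<one>"
      using i C by (simp add: Inr y inv_mult_meet_one_eq_iff)
    then show ?thesis using i by blast
  next
    case False
    then have "\<exists>z. k_ldiv u v = Inr z \<and> z i \<noteq> \<one>"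
      using i C by (simp add: Inr y inv_mult_meet_one_eq_iff)
    then show ?thesis using i by blast
  qed
qed

text \<open>The counterpart of \<open>lg_cong_witness\<close>: again \<open>i\<close> and
  \<open>c\<close> are fixed before the congruence. Within one part a division followed by isolating
  a coordinate yields them; across the parts everything above collapses, and any \<open>i\<close>
  and \<open>c\<close> will do.\<close>

lemma kite_cong_witness:
  assumes u: "u \<in> carrier K" and v: "v \<in> carrier K" and neq: "u \<noteq> v"
  obtains i c where "i \<in> I" "c \<in> neg_cone G" "c \<noteq> \<one>"
    "\<And>\<theta>. k_cong \<theta> \<Longrightarrow> (u, v) \<in> \<theta> \<Longrightarrow> (single i c, k_one) \<in> \<theta>"
proof (cases "isl u = isl v")
  case True
  then obtain x i where i: "i \<in> I" "x i \<noteq> \<one>" and x: "k_ldiv u v = Inr x \<or> k_ldiv v u = Inr x"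
    using ldiv_nontrivial[OF u v neq] by blast
  have "Inr x \<in> carrier K" using x kite_ldiv_closed u v by metis
  then have "x i \<in> neg_cone G" using i by (auto dest: PiE_mem)
  moreover have "(single i (x i), k_one) \<in> \<theta>" if \<theta>: "k_cong \<theta>" and uv: "(u, v) \<in> \<theta>" for \<theta>
    using kite_cong_ldiv[OF \<theta> uv] kite_cong_ldiv[OF \<theta> alg_cong_sym[OF \<theta> uv]] x
    by (intro kite_cong_coordinate[OF \<theta> _ i(1)]) auto
  ultimately show thesis using that i by blast
next
  case False
  obtain i where i: "i \<in> I" using index_nonempty by blast
  obtain c where c: "c \<in> neg_cone G" "c \<noteq> \<one>" by (rule exists_negative)
  have "(single i c, k_one) \<in> \<theta>" if \<theta>: "k_cong \<theta>" and uv: "(u, v) \<in> \<theta>" for \<theta>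
  proof -
    obtain f x where "(Inl f, Inr x) \<in> \<theta>"
      using uv alg_cong_sym[OF \<theta> uv] False by (cases u; cases v) auto
    then show ?thesis
      using kite_cong_collapse[OF \<theta>] c by (simp add: single_def)
  qed
  then show thesis using that i c by blast
qed

section \<open>The normal filter of a congruence at an index\<close>

definition coord_filter :: "(('a, 'i, 'j) kite_elt \<times> ('a, 'i, 'j) kite_elt) set \<Rightarrow> 'i \<Rightarrow> 'a set" where
  "coord_filter \<theta> i = {c \<in> neg_cone G. (single i c, k_one) \<in> \<theta>}"

lemma single_mult: "k_mult (single i c) (single i d) = single i (c \<otimes> d)"
  if "c \<in> carrier G" "d \<in> carrier G"
  using that by (auto simp: single_def fun_eq_iff)

lemma coord_filter_cong:
  assumes \<theta>: "k_cong \<theta>"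
  obtains \<phi> where "lg_cong \<phi>"
    "\<And>x. x \<in> neg_cone G \<Longrightarrow> (x, \<one>) \<in> \<phi> \<longleftrightarrow> x \<in> coord_filter \<theta> i"
proof (rule lg_cong_of_filter[of "coord_filter \<theta> i"])
  note refl = alg_cong_refl[OF \<theta>]
  have N: "c \<in> neg_cone G" "c \<in> carrier G" "(single i c, k_one) \<in> \<theta>"
    if "c \<in> coord_filter \<theta> i" for c
    using that by (auto simp: coord_filter_def neg_coneD)
  show "coord_filter \<theta> i \<subseteq> neg_cone G" by (auto simp: coord_filter_def)
  show "\<one> \<in> coord_filter \<theta> i" using refl by (simp add: coord_filter_def single_one)
  have one_mult: "k_mult k_one k_one = k_one" using single_mult[of \<one> \<one> i] by (simp add: single_one)
  show "c \<otimes> d \<in> coord_filter \<theta> i" if "c \<in> coord_filter \<theta> i" "d \<in> coord_filter \<theta> i" for c d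
    using kite_cong_ops(2)[OF \<theta> N(3)[OF that(1)] N(3)[OF that(2)]] N[OF that(1)] N[OF that(2)]
    by (simp add: coord_filter_def single_mult mult_neg one_mult)
  show "d \<in> coord_filter \<theta> i" if c: "c \<in> coord_filter \<theta> i" and d: "d \<in> neg_cone G" "c \<preceq> d" for c d
  proof -
    have "k_join (single i c) (single i d) = single i d" "k_join k_one (single i d) = k_one"
      using N[OF c] d
      by (auto simp: single_def kite_one_def fun_eq_iff neg_cone_iff join_eq_left join_eq_right)
    then show ?thesis
      using kite_cong_ops(1)[OF \<theta> N(3)[OF c] refl[OF single_in_kite[OF d(1), of i]]] d
      by (simp add: coord_filter_def)
  qed
  have conj_neg: "a \<otimes> c \<otimes> inv a \<in> coord_filter \<theta> i" "inv a \<otimes> (c \<otimes> a) \<in> coord_filter \<theta> i"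
    if c: "c \<in> coord_filter \<theta> i" and a: "a \<in> neg_cone G" for a c
  proof -
    have aC: "a \<in> carrier G" and cC: "c \<in> carrier G" "c \<preceq> \<one>"
      using a N[OF c] by (auto simp: neg_cone_iff)
    have neg: "a \<otimes> c \<otimes> inv a \<in> neg_cone G" "inv a \<otimes> (c \<otimes> a) \<in> neg_cone G"
      using translation_mono[of c \<one> a "inv a"] translation_mono[of c \<one> "inv a" a] aC cC
      by (auto simp: neg_cone_iff m_assoc)
    have "k_rdiv (k_mult (single i a) (single i c)) (single i a) = single i (a \<otimes> c \<otimes> inv a)"
      "k_ldiv (single i a) (k_mult (single i c) (single i a)) = single i (inv a \<otimes> (c \<otimes> a))"
      using neg aC cC by (auto simp: single_def fun_eq_iff meet_eq_left neg_cone_iff)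
    moreover have "k_mult (single i a) k_one = single i a" "k_mult k_one (single i a) = single i a"
      using single_mult[of a \<one> i] single_mult[of \<one> a i] aC by (simp_all add: single_one)
    moreover note a' = refl[OF single_in_kite[OF a, of i]]
    ultimately show "a \<otimes> c \<otimes> inv a \<in> coord_filter \<theta> i" "inv a \<otimes> (c \<otimes> a) \<in> coord_filter \<theta> i"
      using neg kite_cong_ops(4)[OF \<theta> kite_cong_ops(2)[OF \<theta> a' N(3)[OF c]] a']
        kite_cong_ops(3)[OF \<theta> a' kite_cong_ops(2)[OF \<theta> N(3)[OF c] a']]
      by (simp_all add: coord_filter_def kite_ldiv_self kite_rdiv_self single_in_kite[OF a])
  qed
  show "u \<otimes> c \<otimes> inv u \<in> coord_filter \<theta> i" if c: "c \<in> coord_filter \<theta> i" and u: "u \<in> carrier G" for c u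
  proof -
    \<comment> \<open>Every \<open>u\<close> is a quotient \<open>inv a \<otimes> b\<close> of
      negative elements: \<open>b = a \<otimes> u\<close> is negative because \<open>u\<close> lies
      below \<open>u \<curlyvee> \<one>\<close>, the inverse of \<open>a\<close>. Conjugation by
      \<open>u\<close> is thus composed of the two kinds above.\<close>
    define a where "a = inv (u \<curlyvee> \<one>)"
    define b where "b = a \<otimes> u"
    have a: "a \<in> neg_cone G" "a \<in> carrier G" using inv_pos[OF join_pos[OF u one_pos]] by (auto simp: a_def neg_coneD)
    have b: "b \<in> neg_cone G" "b \<in> carrier G"
      using le_mult_iff[of a u \<one>] a u join_upper1[of u \<one>] by (auto simp: b_def neg_cone_iff a_def)
    have "u = inv a \<otimes> b" using a u by (simp add: b_def m_assoc[symmetric])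
    moreover have "inv a \<otimes> (b \<otimes> c \<otimes> inv b \<otimes> a) = (inv a \<otimes> b) \<otimes> c \<otimes> inv (inv a \<otimes> b)"
      using a b N[OF c] by (simp add: m_assoc inv_mult_group)
    ultimately show ?thesis using conj_neg(2)[OF conj_neg(1)[OF c b(1)] a(1)] by simp
  qed
qed (use that in blast)

text \<open>Let \<open>f\<close> be the lower element with entry \<open>inv c\<close> at
  \<open>j\<close> and \<open>\<one>\<close> elsewhere. Multiplying
  \<open>single (lam j) c ~ 1\<close> by \<open>f\<close> gives \<open>0 ~ f\<close>, and dividing
  by \<open>f\<close> on the other side gives \<open>single (rho j) c ~ 1\<close>. The converse is
  the mirror image.\<close>

lemma coord_filter_step:
  assumes \<theta>: "k_cong \<theta>" and j: "j \<in> J"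
  shows "coord_filter \<theta> (lam j) = coord_filter \<theta> (rho j)"
proof -
  note refl = alg_cong_refl[OF \<theta>]
  have "(single (lam j) c, k_one) \<in> \<theta> \<longleftrightarrow> (single (rho j) c, k_one) \<in> \<theta>" if c: "c \<in> neg_cone G" for c
  proof -
    have cC: "c \<in> carrier G" "c \<preceq> \<one>" using c by (auto simp: neg_cone_iff)
    define f where "f = (\<lambda>k\<in>J. if k = j then inv c else \<one>)"
    have f: "f \<in> J \<rightarrow>\<^sub>E pos_cone G" using inv_neg[OF c] by (auto simp: f_def)
    then have F: "Inl f \<in> carrier K" by simp
    have fC: "f k \<in> carrier G" "\<one> \<preceq> f k" if "k \<in> J" for k
      using PiE_mem[OF f that] by (auto simp: pos_cone_iff)
    \<comment> \<open>Injectivity ensures that the upper entry \<open>c\<close> meets the lower part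
      at the coordinate \<open>j\<close> only.\<close>
    have lam_eq: "lam k = lam j \<longleftrightarrow> k = j" and rho_eq: "rho k = rho j \<longleftrightarrow> k = j" if "k \<in> J" for k
      using that j lam_inj rho_inj by (auto dest: inj_onD)
    have unit: "k_mult k_one (Inl f) = Inl f" "k_mult (Inl f) k_one = Inl f"
      using fC f by (auto simp: kite_one_def fun_eq_iff join_eq_left PiE_arb[OF f])
    have annihilate: "k_mult (single (lam j) c) (Inl f) = k_zero" "k_mult (Inl f) (single (rho j) c) = k_zero"
      using cC by (auto simp: single_def kite_zero_def f_def fun_eq_iff lam_eq rho_eq join_eq_left)
    have quot: "k_ldiv (Inl f) k_zero = single (rho j) c" "k_rdiv k_zero (Inl f) = single (lam j) c"
      using cC j
      by (auto simp: single_def kite_zero_def f_def fun_eq_iff lam_eq rho_eq meet_eq_left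
          the_inv_into_f_f[OF rho_inj] the_inv_into_f_f[OF lam_inj])
    show ?thesis
    proof
      assume "(single (lam j) c, k_one) \<in> \<theta>"
      from kite_cong_ops(3)[OF \<theta> refl[OF F] kite_cong_ops(2)[OF \<theta> this refl[OF F]]]
      show "(single (rho j) c, k_one) \<in> \<theta>"
        unfolding unit annihilate quot kite_ldiv_self[OF F] .
    next
      assume "(single (rho j) c, k_one) \<in> \<theta>"
      from kite_cong_ops(4)[OF \<theta> kite_cong_ops(2)[OF \<theta> refl[OF F] this] refl[OF F]]
      show "(single (lam j) c, k_one) \<in> \<theta>"
        unfolding unit annihilate quot kite_rdiv_self[OF F] .
    qed
  qed
  then show ?thesis by (auto simp: coord_filter_def)
qed

end

section \<open>Connectedness of the index set\<close>

text \<open>Replaces the partial inverse by an edge \<open>j\<close> joining \<open>h j\<close> to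
  \<open>g j\<close>, the form in which all later arguments use the steps.\<close>

lemma partial_inv_comp_iff:
  assumes "inj_on h J"
  shows "((Some \<circ> g) \<circ>\<^sub>m partial_inv J h) i = Some k \<longleftrightarrow> (\<exists>j\<in>J. h j = i \<and> g j = k)"
proof -
  have "(\<exists>j\<in>J. h j = i \<and> g j = k) \<longleftrightarrow> i \<in> h ` J \<and> g (the_inv_into J h i) = k"
    using the_inv_into_f_f[OF assms] by auto
  then show ?thesis by (auto simp: map_comp_def partial_inv_def)
qed

lemma partial_pow_Suc_eq_Some_iff:
  "partial_pow p (Suc m) i = Some k \<longleftrightarrow> (\<exists>l. partial_pow p m i = Some l \<and> p l = Some k)"
  by (auto simp: map_comp_Some_iff)

lemma partial_pow_invariant:
  assumes "partial_pow p m i = Some k" "\<And>l l'. p l = Some l' \<Longrightarrow> f l = f l'"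
  shows "f i = f k"
  using assms(1)
proof (induction m arbitrary: k)
  case (Suc m)
  then obtain l where "partial_pow p m i = Some l" "p l = Some k"
    unfolding partial_pow_Suc_eq_Some_iff by blast
  then show ?case using Suc.IH assms(2) by metis
qed simp

context kite_frame
begin

abbreviation "pstep \<equiv> (Some \<circ> rho) \<circ>\<^sub>m partial_inv J lam"
abbreviation "qstep \<equiv> (Some \<circ> lam) \<circ>\<^sub>m partial_inv J rho"

text \<open>Each \<open>j\<close> is an edge from \<open>lam j\<close> to \<open>rho j\<close>. By
  injectivity an index has at most one outgoing and one incoming edge, so walking only forwards or
  only backwards covers a whole connected component.\<close>

definition reach :: "'i \<Rightarrow> 'i \<Rightarrow> bool" where
  "reach i k \<longleftrightarrow> (\<exists>m. partial_pow pstep m i = Some k \<or> partial_pow qstep m i = Some k)"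

lemmas step_iff = partial_inv_comp_iff[OF lam_inj, of rho] partial_inv_comp_iff[OF rho_inj, of lam]

lemma reach_refl: "reach i i"
  unfolding reach_def by (rule exI[of _ 0]) simp

lemma reach_coord_filter:
  assumes "k_cong \<theta>" "reach i k"
  shows "coord_filter \<theta> i = coord_filter \<theta> k"
proof -
  have "coord_filter \<theta> l = coord_filter \<theta> l'" if "pstep l = Some l' \<or> qstep l = Some l'" for l l'
    using that coord_filter_step[OF assms(1)] unfolding step_iff by blast
  then show ?thesis
    using assms(2) partial_pow_invariant[of pstep _ i k "coord_filter \<theta>"]
      partial_pow_invariant[of qstep _ i k "coord_filter \<theta>"]
    unfolding reach_def by blast
qed

text \<open>Makes the set of indices reached from \<open>i\<close> a union of components, so that a
  family of congruences may change on its boundary and still agree at \<open>lam j\<close> and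
  \<open>rho j\<close>.\<close>

lemma reach_step:
  assumes j: "j \<in> J"
  shows "reach i (lam j) \<longleftrightarrow> reach i (rho j)"
proof
  assume "reach i (lam j)"
  then obtain m where "partial_pow pstep m i = Some (lam j) \<or> partial_pow qstep m i = Some (lam j)"
    by (auto simp: reach_def)
  then show "reach i (rho j)"
  proof
    assume "partial_pow pstep m i = Some (lam j)"
    then have "partial_pow pstep (Suc m) i = Some (rho j)"
      unfolding partial_pow_Suc_eq_Some_iff step_iff using j by blast
    then show ?thesis unfolding reach_def by blast
  next
    assume q: "partial_pow qstep m i = Some (lam j)"
    show ?thesis
    \<comment> \<open>With no backward step made, \<open>i\<close> is \<open>lam j\<close> and one
      forward step suffices. Otherwise the last backward step ran along \<open>j\<close>, as
      \<open>lam\<close> is injective, and is undone.\<close>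
    proof (cases m)
      case 0
      then have "partial_pow pstep (Suc 0) i = Some (rho j)"
        using q j unfolding partial_pow_Suc_eq_Some_iff step_iff by auto
      then show ?thesis unfolding reach_def by blast
    next
      case (Suc n)
      then have "partial_pow qstep n i = Some (rho j)"
        using q j lam_inj unfolding Suc partial_pow_Suc_eq_Some_iff step_iff by (auto dest: inj_onD)
      then show ?thesis unfolding reach_def by blast
    qed
  qed
next
  assume "reach i (rho j)"
  then obtain m where "partial_pow pstep m i = Some (rho j) \<or> partial_pow qstep m i = Some (rho j)"
    by (auto simp: reach_def)
  then show "reach i (lam j)"
  proof
    assume "partial_pow qstep m i = Some (rho j)"
    then have "partial_pow qstep (Suc m) i = Some (lam j)"
      unfolding partial_pow_Suc_eq_Some_iff step_iff using j by blast
    then show ?thesis unfolding reach_def by blast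
  next
    assume q: "partial_pow pstep m i = Some (rho j)"
    show ?thesis
    \<comment> \<open>The same with directions exchanged: a forward walk ending in
      \<open>rho j\<close> used the edge \<open>j\<close> last, by injectivity of
      \<open>rho\<close>.\<close>
    proof (cases m)
      case 0
      then have "partial_pow qstep (Suc 0) i = Some (lam j)"
        using q j unfolding partial_pow_Suc_eq_Some_iff step_iff by auto
      then show ?thesis unfolding reach_def by blast
    next
      case (Suc n)
      then have "partial_pow pstep n i = Some (lam j)"
        using q j rho_inj unfolding Suc partial_pow_Suc_eq_Some_iff step_iff by (auto dest: inj_onD)
      then show ?thesis unfolding reach_def by blast
    qed
  qed
qed

section \<open>Subdirectly irreducible kites\<close>

text \<open>With \<open>c\<close> taken from the monolith of \<open>G\<close> and any index
  \<open>k\<close>, the pair \<open>single k c\<close> and \<open>1\<close> is a monolith pair of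
  the kite.\<close>

lemma kite_subdirectly_irreducible:
  assumes si: "subdirectly_irreducible lgroup_ar (lgroup_alg G)"
    and conn: "\<And>i k. i \<in> I \<Longrightarrow> k \<in> I \<Longrightarrow> reach i k"
  shows "subdirectly_irreducible kite_ar K"
proof -
  obtain a b where m: "monolith_pair lgroup_ar (lgroup_alg G) a b"
    using subdirectly_irreducibleD[OF si] by blast
  then have "a \<in> carrier G" "b \<in> carrier G" "a \<noteq> b" by (auto simp: monolith_pair_def lgroup_alg_def)
  then obtain c where c: "c \<in> neg_cone G" "c \<noteq> \<one>"
    and cm: "\<And>\<phi>. lg_cong \<phi> \<Longrightarrow> (a, b) \<in> \<phi> \<Longrightarrow> (c, \<one>) \<in> \<phi>"
    using lg_cong_witness by blast
  obtain k where k: "k \<in> I" using index_nonempty by blast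
  have "(single k c, k_one) \<in> \<theta>" if \<theta>: "k_cong \<theta>" and uv: "(u, v) \<in> \<theta>" "u \<noteq> v" for \<theta> u v
  proof -
    obtain i d where i: "i \<in> I" and d: "d \<in> neg_cone G" "d \<noteq> \<one>" "(single i d, k_one) \<in> \<theta>"
      using kite_cong_witness[OF alg_cong_carrier[OF \<theta> uv(1)] uv(2)] \<theta> uv(1) by metis
    obtain \<phi> where \<phi>: "lg_cong \<phi>"
      and \<phi>_iff: "\<And>x. x \<in> neg_cone G \<Longrightarrow> (x, \<one>) \<in> \<phi> \<longleftrightarrow> x \<in> coord_filter \<theta> i"
      using coord_filter_cong[OF \<theta>] by blast
    have "(d, \<one>) \<in> \<phi>" using d by (simp add: \<phi>_iff coord_filter_def)
    \<comment> \<open>As \<open>d\<close> is not \<open>\<one>\<close>, the congruence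
      \<open>\<phi>\<close> is nontrivial and therefore contains the monolith pair
      \<open>(a, b)\<close>.\<close>
    then have "(c, \<one>) \<in> \<phi>" using cm[OF \<phi> monolith_pairD[OF m \<phi>]] d by blast
    then have "c \<in> coord_filter \<theta> k"
      using c \<phi>_iff reach_coord_filter[OF \<theta> conn[OF i k]] by simp
    then show ?thesis by (simp add: coord_filter_def)
  qed
  then have "monolith_pair kite_ar K (single k c) k_one"
    using single_in_kite[OF c(1)] single_neq_one[OF k c(2)] by (auto simp: monolith_pair_def simp del: kite_carrier_simps)
  then show ?thesis by (rule subdirectly_irreducibleI[OF kite_is_algebra])
qed

lemma subdirectly_irreducible_kiteD:
  assumes si: "subdirectly_irreducible kite_ar K"
  shows "subdirectly_irreducible lgroup_ar (lgroup_alg G)"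
    and "\<And>i k. i \<in> I \<Longrightarrow> k \<in> I \<Longrightarrow> reach i k"
proof -
  obtain u v where m: "monolith_pair kite_ar K u v"
    using subdirectly_irreducibleD[OF si] by blast
  then have "u \<in> carrier K" "v \<in> carrier K" "u \<noteq> v" by (auto simp: monolith_pair_def)
  then obtain l c where l: "l \<in> I" and c: "c \<in> neg_cone G" "c \<noteq> \<one>"
    and cm: "\<And>\<theta>. k_cong \<theta> \<Longrightarrow> (u, v) \<in> \<theta> \<Longrightarrow> (single l c, k_one) \<in> \<theta>"
    using kite_cong_witness by metis
  \<comment> \<open>A glued family that identifies some \<open>d \<noteq> \<one>\<close> with
    \<open>\<one>\<close> at any index is a nontrivial congruence of the kite. It must then identify
    \<open>c\<close> with \<open>\<one>\<close> at the fixed index \<open>l\<close>.\<close>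
  have main: "(c, \<one>) \<in> \<phi> l"
    if \<phi>: "\<And>i. i \<in> I \<Longrightarrow> lg_cong (\<phi> i)" and glue: "\<And>j. j \<in> J \<Longrightarrow> \<phi> (lam j) = \<phi> (rho j)"
      and i: "i \<in> I" and d: "d \<in> neg_cone G" "d \<noteq> \<one>" "(d, \<one>) \<in> \<phi> i" for \<phi> i d
  proof -
    have \<theta>: "k_cong (coord_cong \<phi>)" using \<phi> glue by (rule coord_cong_kite_cong)
    have "(single i d, k_one) \<in> coord_cong \<phi>" using coord_cong_single[of i d \<phi>] i d \<phi> by blast
    then have "(single l c, k_one) \<in> coord_cong \<phi>"
      using cm[OF \<theta> monolith_pairD[OF m \<theta>]] single_neq_one[OF i d(2)] by blast
    then show ?thesis using coord_cong_single[of l c \<phi>] l c \<phi> by blast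
  qed
  have "(c, \<one>) \<in> \<phi>" if \<phi>: "lg_cong \<phi>" and xy: "(x, y) \<in> \<phi>" "x \<noteq> y" for \<phi> x y
  proof -
    obtain d where "d \<in> neg_cone G" "d \<noteq> \<one>" "(d, \<one>) \<in> \<phi>"
      using lg_cong_witness[OF lg_cong_carrier[OF \<phi> xy(1)] xy(2)] \<phi> xy(1) by metis
    then show ?thesis using main[of "\<lambda>_. \<phi>" l d] \<phi> l by blast
  qed
  then have "monolith_pair lgroup_ar (lgroup_alg G) c \<one>"
    using c neg_coneD by (auto simp: monolith_pair_def lgroup_alg_def)
  then show "subdirectly_irreducible lgroup_ar (lgroup_alg G)"
    by (rule subdirectly_irreducibleI[OF lgroup_is_algebra])
  show "reach i k" if i: "i \<in> I" and k: "k \<in> I" for i k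
  proof (rule ccontr)
    assume not: "\<not> reach i k"
    let ?\<phi> = "\<lambda>C l. if l \<in> C then Id_on (carrier G) else carrier G \<times> carrier G"
    \<comment> \<open>The family is the identity on \<open>C\<close> and total off \<open>C\<close>,
      and glues when no edge leaves or enters \<open>C\<close>. As \<open>c \<noteq> \<one>\<close>,
      the conclusion is impossible for \<open>l\<close> in \<open>C\<close>.\<close>
    have cases: "(c, \<one>) \<in> ?\<phi> C l"
      if "\<And>j. j \<in> J \<Longrightarrow> lam j \<in> C \<longleftrightarrow> rho j \<in> C" and "k' \<in> I" "k' \<notin> C" for C k'
    proof (rule main[of "?\<phi> C" k' c])
      show "lg_cong (?\<phi> C l)" for l using lg_cong_Id lg_cong_full by simp
    qed (use that c neg_coneD in auto)
    show False
    \<comment> \<open>\<open>C\<close> is whichever of the reachable set and its complement contains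
      \<open>l\<close>. The index outside \<open>C\<close> is \<open>k\<close> in the first case and
      \<open>i\<close> in the second.\<close>
    proof (cases "reach i l")
      case True
      then show False using cases[of "{l. reach i l}" k] not k reach_step c by auto
    next
      case False
      then show False using cases[of "{l. \<not> reach i l}" i] i reach_refl reach_step c by auto
    qed
  qed
qed

end

theorem theorem5p5:
  fixes G :: "('a, 'm) lgroup_scheme"
    and I :: "'i set" and J :: "'j set"
    and lam rho :: "'j \<Rightarrow> 'i"
  assumes "lgroup G"
    and "carrier G \<noteq> {\<one>\<^bsub>G\<^esub>}"
    and "I \<noteq> {}"
    and "lam \<in> J \<rightarrow> I" and "inj_on lam J"
    and "rho \<in> J \<rightarrow> I" and "inj_on rho J"
  shows
    "(subdirectly_irreducible lgroup_ar (lgroup_alg G) \<and>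
      (\<forall>i\<in>I. \<forall>j\<in>I. \<exists>m::nat.
         partial_pow ((Some \<circ> rho) \<circ>\<^sub>m partial_inv J lam) m i = Some j \<or>
         partial_pow ((Some \<circ> lam) \<circ>\<^sub>m partial_inv J rho) m i = Some j))
     \<longleftrightarrow> subdirectly_irreducible kite_ar (kite G I J lam rho)"
proof -
  interpret kite_frame G I J lam rho
    using assms by (intro kite_frame.intro kite_frame_axioms.intro)
  show ?thesis
    unfolding reach_def[symmetric]
    using kite_subdirectly_irreducible subdirectly_irreducible_kiteD by blast
qed

end
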